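(* Let $I\subset\mathbb R$ be an open interval containing the origin, and $k$ a non-negative integer. The following conditions on a distribution $\sigma\in C^{-\infty}(I)$ are equivalent: (a) $\sigma$ vanishes to order $k$ at the origin. (b) There exist an open interval $J$ with $0\in J\subset I$, an integer $N\ge0$, and functions $h_j\in L^\infty_{\rm loc}(J)$, $0\le j\le N$, such that on $J$, $\sigma=\sum_{j=0}^N x^{k+j}\frac{d^j}{dx^j}h_j$. (c) There exist an open interval $J$ with $0\in J\subset I$, an integer $N\ge0$, and functions $h_j\in L^\infty_{\rm loc}(J)$, $0\le j\le N$, such that on $J$, $\sigma=\sum_{j=0}^N \frac{d^j}{dx^j}(x^{k+j}h_j)$. (d) There exist an open interval $J$ with $0\in J\subset I$, an integer $N\ge0$, and a function $h\in L^\infty_{\rm loc}(J)$, such that on $J$, $\sigma=x^k\left(\frac{d}{dx}\circ x\right)^N h$. If $\sigma\in C^{-\infty}(I)$ vanishes to order $k+1$ at the origin, it satisfies the three conditions (b)–(d) (for the given $k$) even with $h_j\in C(J)$, respectively $h\in C(J)$. If $k\ge1$, and if $\sigma$ satisfies any of the conditions (b)–(d), but with $h_j\in L^1_{\rm loc}(J)$, respectively $h\in L^1_{\rm loc}(J)$, then $\sigma$ vanishes to order $k-1$ at the origin.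
   Context: $C^{-\infty}(I)$ is the space of distributions on $I$, i.e. the dual of compactly supported smooth measures on $I$; locally $L^1$ functions are regarded as distributions. Here $x$ also denotes the operator of multiplication by $x$, and $\circ$ composition of operators. A linear differential operator $D$ with $C^\infty$ coefficients near $0$ is tangential to $\{0\}$ if, for every $m\in\mathbb N$, it maps smooth functions vanishing to order $m$ at $0$ (i.e. divisible by $x^m$) to functions vanishing to order $m$ at $0$. A distribution $\sigma$ vanishes to order $k\ge0$ at $0$ if there is an open neighborhood $U$ of $0$ on which $\sigma=\sum_{1\le j\le N}f_jD_jh_j$, with $h_j\in L^\infty_{\rm loc}(U)$, $D_j$ differential operators on $U$ tangential to $\{0\}$, and $f_j\in C^\infty(U)$ vanishing to order $k$ at $0$. *)

theory Defs
  imports "HOL-Analysis.Analysis"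
begin

text \<open>All functions are complex valued functions of a real variable. A function or functional
  on an open set \<open>U\<close> is represented by a total one whose values outside \<open>U\<close> (respectively, outside
  the test functions on \<open>U\<close>) are irrelevant.\<close>

definition vderiv :: "(real \<Rightarrow> complex) \<Rightarrow> real \<Rightarrow> complex" where
  "vderiv f = (\<lambda>x. vector_derivative f (at x))"

definition smooth_on :: "real set \<Rightarrow> (real \<Rightarrow> complex) \<Rightarrow> bool" where
  "smooth_on U f \<longleftrightarrow> (\<forall>n. \<forall>x\<in>U. (vderiv ^^ n) f differentiable (at x))"

definition vanishing_fun :: "real set \<Rightarrow> nat \<Rightarrow> (real \<Rightarrow> complex) \<Rightarrow> bool" where
  "vanishing_fun U m f \<longleftrightarrow> smooth_on U f \<and>
     (\<exists>q. smooth_on U q \<and> (\<forall>x\<in>U. f x = of_real x ^ m * q x))"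

definition test_functions :: "real set \<Rightarrow> (real \<Rightarrow> complex) set" where
  "test_functions U = {\<phi>. smooth_on UNIV \<phi> \<and>
     compact (closure {x. \<phi> x \<noteq> 0}) \<and> closure {x. \<phi> x \<noteq> 0} \<subseteq> U}"

text \<open>The test function \<open>\<phi>\<close> stands for the compactly supported smooth measure \<open>\<phi> dx\<close>. Continuity
  for the inductive limit topology is expressed by the usual seminorm estimates on each
  compact set.\<close>

definition distribution_on :: "real set \<Rightarrow> ((real \<Rightarrow> complex) \<Rightarrow> complex) \<Rightarrow> bool" where
  "distribution_on U u \<longleftrightarrow>
     (\<forall>\<phi>\<in>test_functions U. \<forall>\<psi>\<in>test_functions U. u (\<lambda>x. \<phi> x + \<psi> x) = u \<phi> + u \<psi>) \<and>
     (\<forall>c. \<forall>\<phi>\<in>test_functions U. u (\<lambda>x. c * \<phi> x) = c * u \<phi>) \<and>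
     (\<forall>K. compact K \<and> K \<subseteq> U \<longrightarrow>
        (\<exists>C m. \<forall>\<phi>\<in>test_functions U. closure {x. \<phi> x \<noteq> 0} \<subseteq> K \<longrightarrow>
           norm (u \<phi>) \<le> C * (\<Sum>i\<le>m. SUP x. norm ((vderiv ^^ i) \<phi> x))))"

definition dist_eq_on ::
  "real set \<Rightarrow> ((real \<Rightarrow> complex) \<Rightarrow> complex) \<Rightarrow> ((real \<Rightarrow> complex) \<Rightarrow> complex) \<Rightarrow> bool" where
  "dist_eq_on U u v \<longleftrightarrow> (\<forall>\<phi>\<in>test_functions U. u \<phi> = v \<phi>)"

definition dist_of :: "(real \<Rightarrow> complex) \<Rightarrow> (real \<Rightarrow> complex) \<Rightarrow> complex" where
  "dist_of f = (\<lambda>\<phi>. LINT x|lebesgue. f x * \<phi> x)"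

definition dist_mult ::
  "(real \<Rightarrow> complex) \<Rightarrow> ((real \<Rightarrow> complex) \<Rightarrow> complex) \<Rightarrow> (real \<Rightarrow> complex) \<Rightarrow> complex" where
  "dist_mult f u = (\<lambda>\<phi>. u (\<lambda>x. f x * \<phi> x))"

definition dist_deriv :: "((real \<Rightarrow> complex) \<Rightarrow> complex) \<Rightarrow> (real \<Rightarrow> complex) \<Rightarrow> complex" where
  "dist_deriv u = (\<lambda>\<phi>. - u (vderiv \<phi>))"

abbreviation xpow :: "nat \<Rightarrow> real \<Rightarrow> complex" where
  "xpow n \<equiv> (\<lambda>x. of_real x ^ n)"

definition L1_loc :: "real set \<Rightarrow> (real \<Rightarrow> complex) set" where
  "L1_loc U = {f. \<forall>K. compact K \<and> K \<subseteq> U \<longrightarrow> f absolutely_integrable_on K}"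

definition Linf_loc :: "real set \<Rightarrow> (real \<Rightarrow> complex) set" where
  "Linf_loc U = {f. f \<in> borel_measurable (lebesgue_on U) \<and>
     (\<forall>K. compact K \<and> K \<subseteq> U \<longrightarrow> (\<exists>C. AE x\<in>K in lebesgue. norm (f x) \<le> C))}"

definition C0 :: "real set \<Rightarrow> (real \<Rightarrow> complex) set" where
  "C0 U = {f. continuous_on U f}"

text \<open>The list \<open>[a\<^sub>0, \<dots>, a\<^sub>n]\<close> of coefficients represents the operator \<open>\<Sum>i\<le>n. a\<^sub>i d\<^sup>i/dx\<^sup>i\<close>.\<close>

type_synonym diffop = "(real \<Rightarrow> complex) list"

definition diffop_on :: "real set \<Rightarrow> diffop \<Rightarrow> bool" where
  "diffop_on U D \<longleftrightarrow> (\<forall>a\<in>set D. smooth_on U a)"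

definition apply_fun :: "diffop \<Rightarrow> (real \<Rightarrow> complex) \<Rightarrow> real \<Rightarrow> complex" where
  "apply_fun D g = (\<lambda>x. \<Sum>i<length D. (D ! i) x * (vderiv ^^ i) g x)"

definition apply_dist ::
  "diffop \<Rightarrow> ((real \<Rightarrow> complex) \<Rightarrow> complex) \<Rightarrow> (real \<Rightarrow> complex) \<Rightarrow> complex" where
  "apply_dist D u = (\<lambda>\<phi>. \<Sum>i<length D. dist_mult (D ! i) ((dist_deriv ^^ i) u) \<phi>)"

definition tangential :: "real set \<Rightarrow> diffop \<Rightarrow> bool" where
  "tangential U D \<longleftrightarrow> diffop_on U D \<and>
     (\<forall>m g. vanishing_fun U m g \<longrightarrow> vanishing_fun U m (apply_fun D g))"

definition vanishes_to_order ::
  "real set \<Rightarrow> nat \<Rightarrow> ((real \<Rightarrow> complex) \<Rightarrow> complex) \<Rightarrow> bool" where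
  "vanishes_to_order I k \<sigma> \<longleftrightarrow>
     (\<exists>U N f D h. open U \<and> 0 \<in> U \<and> U \<subseteq> I \<and>
        (\<forall>j\<in>{1..N::nat}. h j \<in> Linf_loc U \<and> tangential U (D j) \<and> vanishing_fun U k (f j)) \<and>
        dist_eq_on U \<sigma>
          (\<lambda>\<phi>. \<Sum>j=1..N. dist_mult (f j) (apply_dist (D j) (dist_of (h j))) \<phi>))"

definition open_subinterval :: "real set \<Rightarrow> real set \<Rightarrow> bool" where
  "open_subinterval J I \<longleftrightarrow> open J \<and> is_interval J \<and> 0 \<in> J \<and> J \<subseteq> I"

text \<open>The parameter \<open>F\<close> is the class of admissible functions: \<open>Linf_loc\<close>, \<open>C0\<close> or \<open>L1_loc\<close>.\<close>

definition cond_b ::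
  "(real set \<Rightarrow> (real \<Rightarrow> complex) set) \<Rightarrow> real set \<Rightarrow> nat \<Rightarrow> ((real \<Rightarrow> complex) \<Rightarrow> complex) \<Rightarrow> bool"
where
  "cond_b F I k \<sigma> \<longleftrightarrow>
     (\<exists>J N h. open_subinterval J I \<and> (\<forall>j\<le>N. h j \<in> F J) \<and>
        dist_eq_on J \<sigma>
          (\<lambda>\<phi>. \<Sum>j\<le>N. dist_mult (xpow (k + j)) ((dist_deriv ^^ j) (dist_of (h j))) \<phi>))"

definition cond_c ::
  "(real set \<Rightarrow> (real \<Rightarrow> complex) set) \<Rightarrow> real set \<Rightarrow> nat \<Rightarrow> ((real \<Rightarrow> complex) \<Rightarrow> complex) \<Rightarrow> bool"
where
  "cond_c F I k \<sigma> \<longleftrightarrow>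
     (\<exists>J N h. open_subinterval J I \<and> (\<forall>j\<le>N. h j \<in> F J) \<and>
        dist_eq_on J \<sigma>
          (\<lambda>\<phi>. \<Sum>j\<le>N. (dist_deriv ^^ j) (dist_of (\<lambda>x. xpow (k + j) x * h j x)) \<phi>))"

definition cond_d ::
  "(real set \<Rightarrow> (real \<Rightarrow> complex) set) \<Rightarrow> real set \<Rightarrow> nat \<Rightarrow> ((real \<Rightarrow> complex) \<Rightarrow> complex) \<Rightarrow> bool"
where
  "cond_d F I k \<sigma> \<longleftrightarrow>
     (\<exists>J N h. open_subinterval J I \<and> h \<in> F J \<and>
        dist_eq_on J \<sigma>
          (dist_mult (xpow k) (((dist_deriv \<circ> dist_mult of_real) ^^ N) (dist_of h))))"

end

theory Submission
  imports Defs
begin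

text \<open>Let \<open>E = x d/dx\<close>. On the side of the test functions, each of the conditions (b), (c), (d) reads
  \<open>\<sigma>(\<phi>) = \<Sum>\<^sub>j \<integral> h\<^sub>j P\<^sub>j(E)(x\<^sup>k \<phi>) dx\<close> with \<open>P\<^sub>j\<close> a polynomial of degree \<open>j\<close>, and so does (a), since
  an operator is tangential to \<open>{0}\<close> exactly if its \<open>i\<close>-th coefficient is divisible by \<open>x\<^sup>i\<close>. The
  choice of the \<open>P\<^sub>j\<close> is immaterial, so (a), (b), (c) are equivalent. For (d) all terms are brought
  to the same degree by \<open>\<integral> h \<psi> = \<integral> g E\<psi>\<close> with \<open>g(x) = - (1/x) \<integral>\<^sub>0\<^sup>x h\<close>, which is locally bounded
  (continuous) if \<open>h\<close> is. If \<open>h\<close> is only locally integrable, the same construction applied to \<open>x h\<close>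
  yields a continuous \<open>g\<close>; thus a factor \<open>x\<close> improves \<open>L\<^sup>1\<close> coefficients to continuous ones, which
  gives the last two assertions.\<close>

subsection \<open>Smooth functions and test functions\<close>

text \<open>A change of the polynomials multiplies the coefficients by constants only, so every
  vector space of locally integrable functions allows it. Condition (a) also requires stability
  under smooth factors, because its operators have variable coefficients. The antiderivative starts
  at 0 because the division by \<open>x\<close> consumes the zero that
  \<open>\<integral>_0^x h\<close> has there; hence an interval \<open>J\<close> around 0. For
  merely integrable \<open>h\<close> the construction can leave the class:
  \<open>h(t) = 1/(t log^2 t)\<close> near 0+ leads to a multiple of \<open>1/(x log x)\<close>,
  which is not integrable. For \<open>L1_loc\<close>, therefore, only the passage from (d) to the
  common form is used. The primitive of an integrable \<open>h\<close> need not be differentiable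
  everywhere, so its partial integration against test functions comes from Fubini's theorem and not
  from the product rule.\<close>

lemma vderiv_eqI: "(f has_vector_derivative d) (at x) \<Longrightarrow> vderiv f x = d"
  by (simp add: vderiv_def vector_derivative_at)

lemma vderiv_cong_open:
  assumes "open U" "\<And>x. x \<in> U \<Longrightarrow> f x = g x" "x \<in> U"
  shows "vderiv f x = vderiv g x"
  unfolding vderiv_def
proof (rule vector_derivative_cong_eq)
  show "\<forall>\<^sub>F y in nhds x. y \<in> UNIV \<longrightarrow> f y = g y"
    using assms by (auto simp: eventually_nhds)
qed auto

lemma funpow_vderiv_cong_open:
  assumes "open U" "\<And>x. x \<in> U \<Longrightarrow> f x = g x" "x \<in> U"
  shows "(vderiv ^^ n) f x = (vderiv ^^ n) g x"
  using assms(3)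
proof (induction n arbitrary: x)
  case 0
  then show ?case using assms(2) by simp
next
  case (Suc n)
  then show ?case using vderiv_cong_open[OF assms(1) Suc.IH] by simp
qed

lemma differentiable_cong_open:
  assumes "open U" "\<And>x. x \<in> U \<Longrightarrow> f x = g x" "x \<in> U"
  shows "f differentiable at x \<longleftrightarrow> g differentiable at x"
  using has_derivative_transform_within_open[OF _ assms(1,3)] assms(2)
  unfolding differentiable_def by (metis (no_types, lifting))

lemma smooth_on_cong:
  assumes "open U" "\<And>x. x \<in> U \<Longrightarrow> f x = g x"
  shows "smooth_on U f \<longleftrightarrow> smooth_on U g"
proof -
  have "(vderiv ^^ n) f differentiable at x \<longleftrightarrow> (vderiv ^^ n) g differentiable at x"
    if "x \<in> U" for n x
    using differentiable_cong_open[OF assms(1) funpow_vderiv_cong_open[OF assms] that] .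
  then show ?thesis
    by (auto simp: smooth_on_def)
qed

lemma smooth_on_subset: "smooth_on U f \<Longrightarrow> V \<subseteq> U \<Longrightarrow> smooth_on V f"
  by (auto simp: smooth_on_def)

lemma smooth_on_Un: "smooth_on U f \<Longrightarrow> smooth_on V f \<Longrightarrow> smooth_on (U \<union> V) f"
  by (auto simp: smooth_on_def)

lemma smooth_on_differentiable: "smooth_on U f \<Longrightarrow> x \<in> U \<Longrightarrow> f differentiable at x"
  unfolding smooth_on_def by (metis funpow_0)

lemma smooth_on_has_vderiv:
  "smooth_on U f \<Longrightarrow> x \<in> U \<Longrightarrow> (f has_vector_derivative vderiv f x) (at x)"
  unfolding vderiv_def using smooth_on_differentiable vector_derivative_works by blast

lemma smooth_on_continuous_on: "smooth_on U f \<Longrightarrow> continuous_on U f"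
  by (meson continuous_at_imp_continuous_on differentiable_imp_continuous_within
      smooth_on_differentiable)

lemma smooth_on_vderiv: "smooth_on U f \<Longrightarrow> smooth_on U (vderiv f)"
  unfolding smooth_on_def by (metis comp_apply funpow_Suc_right)

lemma smooth_on_const [simp]: "smooth_on U (\<lambda>x. c)"
proof -
  have "\<exists>c. (vderiv ^^ n) (\<lambda>x. c') = (\<lambda>x. c)" for n and c' :: complex
    by (induction n) (auto simp: vderiv_def)
  then show ?thesis
    unfolding smooth_on_def by (metis differentiable_const)
qed

lemma smooth_on_add:
  assumes "open U" "smooth_on U f" "smooth_on U g"
  shows "smooth_on U (\<lambda>x. f x + g x)"
proof -
  have "\<forall>x\<in>U. (vderiv ^^ n) (\<lambda>x. f x + g x) x = (vderiv ^^ n) f x + (vderiv ^^ n) g x" for n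
  proof (induction n)
    case (Suc n)
    show ?case
    proof
      fix x assume x: "x \<in> U"
      have "(vderiv ^^ Suc n) (\<lambda>x. f x + g x) x
          = vderiv (\<lambda>x. (vderiv ^^ n) f x + (vderiv ^^ n) g x) x"
        using vderiv_cong_open[OF assms(1) _ x] Suc by fastforce
      also have "\<dots> = (vderiv ^^ Suc n) f x + (vderiv ^^ Suc n) g x"
        using assms(2,3) x by (simp add: smooth_on_def vderiv_def)
      finally show "(vderiv ^^ Suc n) (\<lambda>x. f x + g x) x
        = (vderiv ^^ Suc n) f x + (vderiv ^^ Suc n) g x" .
    qed
  qed simp
  then have *: "y \<in> U \<Longrightarrow> (vderiv ^^ n) f y + (vderiv ^^ n) g y = (vderiv ^^ n) (\<lambda>x. f x + g x) y"
    for n y by simp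
  have "(vderiv ^^ n) (\<lambda>x. f x + g x) differentiable at x" if x: "x \<in> U" for n x
  proof -
    have "(\<lambda>y. (vderiv ^^ n) f y + (vderiv ^^ n) g y) differentiable at x"
      using assms(2,3) x by (simp add: smooth_on_def)
    then show ?thesis
      using differentiable_cong_open[of U "\<lambda>y. (vderiv ^^ n) f y + (vderiv ^^ n) g y"
        "(vderiv ^^ n) (\<lambda>x. f x + g x)" x] assms(1) x * by blast
  qed
  then show ?thesis
    by (simp add: smooth_on_def)
qed

lemma vderiv_mult:
  assumes "f differentiable at x" "g differentiable at x"
  shows "vderiv (\<lambda>x. f x * g x) x = f x * vderiv g x + vderiv f x * g x"
  using assms by (simp add: vderiv_def)

lemma vderiv_add:
  assumes "f differentiable at x" "g differentiable at x"
  shows "vderiv (\<lambda>x. f x + g x) x = vderiv f x + vderiv g x"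
  using assms by (simp add: vderiv_def)

lemma vderiv_of_real [simp]: "vderiv of_real = (\<lambda>x. 1)"
  by (rule ext) (use has_vector_derivative_of_real[OF DERIV_ident] in \<open>auto intro: vderiv_eqI\<close>)

text \<open>Induction on the number of derivatives: the derivative of a product is a sum of two
  products, to which the induction hypothesis for one derivative less applies.\<close>

lemma smooth_on_mult:
  assumes U: "open U" and "smooth_on U f" "smooth_on U g"
  shows "smooth_on U (\<lambda>x. f x * g x)"
proof -
  \<comment> \<open>\<open>C n f\<close> says that \<open>f\<close> has \<open>n + 1\<close>
    derivatives on \<open>U\<close>; already \<open>C 0\<close> is differentiability.\<close>
  define C where "C n f \<longleftrightarrow> (\<forall>i\<le>n. \<forall>x\<in>U. (vderiv ^^ i) f differentiable at x)" for n f
  have C_Suc: "C (Suc n) f \<longleftrightarrow> (\<forall>x\<in>U. f differentiable at x) \<and> C n (vderiv f)" for n f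
  proof -
    have "(\<forall>i\<le>Suc n. P i) \<longleftrightarrow> P 0 \<and> (\<forall>i\<le>n. P (Suc i))" for P
      by (metis Suc_le_mono le0 not0_implies_Suc)
    then show ?thesis
      unfolding C_def by (simp add: funpow_swap1)
  qed
  have C_cong: "C n f" if "C n g" "\<And>x. x \<in> U \<Longrightarrow> g x = f x" for n f g
    unfolding C_def
  proof (intro allI impI ballI)
    fix i x assume i: "i \<le> n" and x: "x \<in> U"
    have "\<And>y. y \<in> U \<Longrightarrow> (vderiv ^^ i) g y = (vderiv ^^ i) f y"
      by (rule funpow_vderiv_cong_open[OF U that(2)])
    then show "(vderiv ^^ i) f differentiable at x"
      using \<open>C n g\<close> i x differentiable_cong_open[OF U _ x] unfolding C_def by blast
  qed
  have C_le: "C n f" if "C (Suc n) f" for n f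
    using that by (simp add: C_def)
  have C_add: "C n (\<lambda>x. f x + g x)" if "C n f" "C n g" for n f g
    using that
  proof (induction n arbitrary: f g)
    case 0
    then show ?case by (simp add: C_def)
  next
    case (Suc n)
    then have "C n (\<lambda>x. vderiv f x + vderiv g x)"
      by (simp add: C_Suc)
    then have "C n (vderiv (\<lambda>x. f x + g x))"
      by (rule C_cong) (use Suc.prems in \<open>simp add: C_Suc vderiv_add\<close>)
    then show ?case
      using Suc.prems by (simp add: C_Suc)
  qed
  have C_mult: "C n (\<lambda>x. f x * g x)" if "C n f" "C n g" for n f g
    using that
  proof (induction n arbitrary: f g)
    case 0
    then show ?case by (simp add: C_def)
  next
    case (Suc n)
    then have "C n (\<lambda>x. f x * vderiv g x + vderiv f x * g x)"
      using C_le by (intro C_add Suc.IH) (auto simp: C_Suc)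
    then have "C n (vderiv (\<lambda>x. f x * g x))"
      by (rule C_cong) (use Suc.prems in \<open>simp add: C_Suc vderiv_mult\<close>)
    then show ?case
      using Suc.prems by (simp add: C_Suc)
  qed
  have "C n (\<lambda>x. f x * g x)" for n
    using assms(2,3) by (intro C_mult) (auto simp: C_def smooth_on_def)
  then show ?thesis
    by (auto simp: C_def smooth_on_def)
qed

lemma smooth_on_of_real [simp]: "smooth_on U of_real"
proof -
  have "(vderiv ^^ n) of_real differentiable at x" for n x
  proof (cases n)
    case 0
    then show ?thesis
      using has_vector_derivative_of_real[OF DERIV_ident, of "at x"] differentiableI_vector by auto
  next
    case (Suc m)
    then have "(vderiv ^^ n) of_real = (vderiv ^^ m) (\<lambda>x. 1)"
      by (simp add: funpow_swap1)
    then show ?thesis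
      using smooth_on_const[of UNIV 1] by (simp add: smooth_on_def del: smooth_on_const)
  qed
  then show ?thesis
    by (simp add: smooth_on_def)
qed

lemma smooth_on_xpow: "open U \<Longrightarrow> smooth_on U (xpow n)"
  by (induction n) (auto intro: smooth_on_mult)

lemma smooth_on_sum:
  assumes "open U" "\<And>i. i \<in> A \<Longrightarrow> smooth_on U (f i)"
  shows "smooth_on U (\<lambda>x. \<Sum>i\<in>A. f i x)"
  using assms(2) by (induction A rule: infinite_finite_induct) (auto intro: smooth_on_add[OF assms(1)])

lemma smooth_on_funpow_vderiv: "smooth_on U f \<Longrightarrow> smooth_on U ((vderiv ^^ n) f)"
  by (induction n) (auto intro: smooth_on_vderiv)

lemma vderiv_xpow: "vderiv (xpow (Suc n)) x = of_nat (Suc n) * of_real x ^ n"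
proof (induction n)
  case (Suc n)
  have "vderiv (xpow (Suc (Suc n))) x = vderiv (\<lambda>x. of_real x * xpow (Suc n) x) x"
    by simp
  also have "\<dots> = of_real x * vderiv (xpow (Suc n)) x + of_real x ^ Suc n"
    by (subst vderiv_mult)
      (use smooth_on_differentiable smooth_on_xpow[of UNIV "Suc n"] smooth_on_of_real[of UNIV] in auto)
  finally show ?case
    unfolding Suc by (simp add: algebra_simps)
qed simp

lemma vderiv_const [simp]: "vderiv (\<lambda>x. c) = (\<lambda>x. 0)"
  by (simp add: vderiv_def)

section \<open>Test functions and operations that preserve them\<close>

lemma test_functions_smooth: "\<phi> \<in> test_functions U \<Longrightarrow> smooth_on V \<phi>"
  by (auto simp: test_functions_def intro: smooth_on_subset)

lemma test_functions_mono: "V \<subseteq> U \<Longrightarrow> test_functions V \<subseteq> test_functions U"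
  by (auto simp: test_functions_def)

lemma test_functionsI:
  assumes "\<phi> \<in> test_functions U" "smooth_on UNIV \<psi>" "{x. \<psi> x \<noteq> 0} \<subseteq> closure {x. \<phi> x \<noteq> 0}"
  shows "\<psi> \<in> test_functions U"
proof -
  have "closure {x. \<psi> x \<noteq> 0} \<subseteq> closure {x. \<phi> x \<noteq> 0}"
    using assms(3) closure_minimal by blast
  then show ?thesis
    using assms by (auto simp: test_functions_def compact_eq_bounded_closed bounded_subset)
qed

text \<open>\<open>f\<close> is arbitrary outside \<open>U\<close>. Smoothness is local, and the
  line is covered by \<open>U\<close> and the open complement of the support of
  \<open>\<phi>\<close>, where the product is zero.\<close>

lemma test_functions_mult:
  assumes "\<phi> \<in> test_functions U" "open U" "smooth_on U f"
  shows "(\<lambda>x. f x * \<phi> x) \<in> test_functions U"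
proof (rule test_functionsI[OF assms(1)])
  let ?V = "- closure {x. \<phi> x \<noteq> 0}"
  have "smooth_on U (\<lambda>x. f x * \<phi> x)"
    using smooth_on_mult[OF assms(2,3) test_functions_smooth[OF assms(1)]] .
  moreover have "smooth_on ?V (\<lambda>x. f x * \<phi> x)"
  proof (subst smooth_on_cong)
    show "f x * \<phi> x = 0" if "x \<in> ?V" for x
      using that closure_subset[of "{x. \<phi> x \<noteq> 0}"] by auto
  qed auto
  moreover have "U \<union> ?V = UNIV"
    using assms(1) by (auto simp: test_functions_def)
  ultimately show "smooth_on UNIV (\<lambda>x. f x * \<phi> x)"
    using smooth_on_Un by metis
  show "{x. f x * \<phi> x \<noteq> 0} \<subseteq> closure {x. \<phi> x \<noteq> 0}"
    using closure_subset[of "{x. \<phi> x \<noteq> 0}"] by auto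
qed

lemma test_functions_vderiv:
  assumes "\<phi> \<in> test_functions U"
  shows "vderiv \<phi> \<in> test_functions U"
proof (rule test_functionsI[OF assms])
  show "smooth_on UNIV (vderiv \<phi>)"
    by (intro smooth_on_vderiv test_functions_smooth[OF assms])
  have "vderiv \<phi> x = 0" if "x \<in> - closure {x. \<phi> x \<noteq> 0}" for x
  proof -
    have "vderiv \<phi> x = vderiv (\<lambda>x. 0) x"
      by (rule vderiv_cong_open[OF _ _ that]) (use closure_subset[of "{x. \<phi> x \<noteq> 0}"] in auto)
    then show ?thesis by simp
  qed
  then show "{x. vderiv \<phi> x \<noteq> 0} \<subseteq> closure {x. \<phi> x \<noteq> 0}"
    by auto
qed

lemma test_functions_add:
  assumes "\<phi> \<in> test_functions U" "\<psi> \<in> test_functions U"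
  shows "(\<lambda>x. \<phi> x + \<psi> x) \<in> test_functions U"
proof -
  let ?S = "\<lambda>\<phi>::real \<Rightarrow> complex. {x. \<phi> x \<noteq> 0}"
  have *: "closure (?S (\<lambda>x. \<phi> x + \<psi> x)) \<subseteq> closure (?S \<phi>) \<union> closure (?S \<psi>)"
    unfolding closure_Un[symmetric] by (rule closure_mono) auto
  moreover have "compact (closure (?S \<phi>) \<union> closure (?S \<psi>))"
    using assms by (auto simp: test_functions_def intro: compact_Un)
  ultimately have "compact (closure (?S (\<lambda>x. \<phi> x + \<psi> x)))"
    by (meson bounded_subset closed_closure compact_eq_bounded_closed)
  then show ?thesis
    using assms * by (auto simp: test_functions_def intro: smooth_on_add)
qed

lemma test_functions_scale:
  assumes "\<phi> \<in> test_functions U"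
  shows "(\<lambda>x. c * \<phi> x) \<in> test_functions U"
proof (rule test_functionsI[OF assms])
  show "smooth_on UNIV (\<lambda>x. c * \<phi> x)"
    by (intro smooth_on_mult test_functions_smooth[OF assms]) auto
  show "{x. c * \<phi> x \<noteq> 0} \<subseteq> closure {x. \<phi> x \<noteq> 0}"
    using closure_subset[of "{x. \<phi> x \<noteq> 0}"] by auto
qed

subsection \<open>Antiderivatives for the Euler operator\<close>

text \<open>In place of a pointwise product rule, \<open>\<phi> x\<close> is written as minus the
  integral of \<open>\<phi>'\<close> from \<open>x\<close> to \<open>b\<close>, and the order of
  integration is exchanged. The boundary term at \<open>a\<close> vanishes with the integral from
  \<open>a\<close>.\<close>

lemma integral_by_parts_indefinite:
  fixes h \<phi> :: "real \<Rightarrow> complex"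
  assumes h: "h absolutely_integrable_on {a..b}"
    and deriv: "\<And>x. x \<in> {a..b} \<Longrightarrow> (\<phi> has_vector_derivative \<phi>' x) (at x within {a..b})"
    and cont: "continuous_on {a..b} \<phi>'" and b: "\<phi> b = 0"
  shows "integral {a..b} (\<lambda>x. h x * \<phi> x) = - integral {a..b} (\<lambda>x. integral {a..x} h * \<phi>' x)"
proof -
  \<comment> \<open>Fubini's theorem is applied over \<open>lborel\<close>, whereas \<open>h\<close>
    is only Lebesgue measurable; it is replaced by a Borel function that agrees with it almost
    everywhere.\<close>
  have "\<exists>g'\<in>borel_measurable lborel. AE x in lborel. f x = g' x"
    if f: "f \<in> borel_measurable lebesgue" for f :: "real \<Rightarrow> complex"
  proof -
    obtain g1 where g1: "g1 \<in> borel_measurable lborel" "AE x in lborel. Re (f x) = g1 x"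
      using completion_ex_borel_measurable_real[OF measurable_compose[OF f borel_measurable_Re]] by auto
    obtain g2 where g2: "g2 \<in> borel_measurable lborel" "AE x in lborel. Im (f x) = g2 x"
      using completion_ex_borel_measurable_real[OF measurable_compose[OF f borel_measurable_Im]] by auto
    have "AE x in lborel. f x = Complex (g1 x) (g2 x)"
      using g1(2) g2(2) by eventually_elim (simp add: complex_eq_iff)
    moreover have "(\<lambda>x. Complex (g1 x) (g2 x)) \<in> borel_measurable lborel"
      using g1(1) g2(1) by (simp add: borel_measurable_complex_iff)
    ultimately show ?thesis by (rule bexI)
  qed
  moreover have hI: "integrable lebesgue (\<lambda>x. indicator {a..b} x *\<^sub>R h x)"
    using h by (simp add: set_integrable_def)
  ultimately obtain k0 where k0 [measurable]: "k0 \<in> borel_measurable lborel"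
    and k0_eq: "AE x in lborel. indicator {a..b} x *\<^sub>R h x = k0 x"
    using borel_measurable_integrable by blast
  \<comment> \<open>\<open>k0\<close> vanishes outside \<open>{a..b}\<close> only almost everywhere;
    the second cutoff makes \<open>k\<close> vanish there at every point, as \<open>inner2\<close>
    uses.\<close>
  define k where "k x = indicator {a..b} x *\<^sub>R k0 x" for x
  have k [measurable]: "k \<in> borel_measurable lborel"
    unfolding k_def by measurable
  have k_eq: "AE x in lebesgue. indicator {a..b} x *\<^sub>R h x = k x"
    by (rule AE_completion) (use k0_eq in eventually_elim, auto simp: k_def indicator_def)
  have kI: "integrable lborel k"
    using integrable_cong_AE_imp[OF hI _ k_eq] integrable_completion[OF k]
      measurable_completion[OF k] by auto
  define p where "p = (\<lambda>x. indicator {a..b} x *\<^sub>R \<phi>' x)"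
  have pI: "integrable lborel p"
    using borel_integrable_compact[OF compact_Icc cont] by (simp add: p_def)
  then have p [measurable]: "p \<in> borel_measurable lborel"
    by (rule borel_measurable_integrable)
  \<comment> \<open>Fubini for \<open>k(x) p(s)\<close> on the triangle \<open>x \<le> s\<close>\<close>
  define f where "f = (\<lambda>(x::real, s::real). (if x \<le> s then 1 else 0) * (k x * p s))"
  have f [measurable]: "f \<in> borel_measurable (lborel \<Otimes>\<^sub>M lborel)"
    unfolding f_def by measurable
  have f_int: "integrable lborel (\<lambda>y. f (x, y))" for x
    by (rule Bochner_Integration.integrable_bound[OF integrable_mult_right[OF pI, of "k x"]])
      (auto simp: f_def)
  have "integrable (lborel \<Otimes>\<^sub>M lborel) f"
  proof (rule lborel_pair.Fubini_integrable[OF f _ AE_I2[OF f_int]])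
    show "integrable lborel (\<lambda>x. LINT y|lborel. norm (f (x, y)))"
    proof (rule Bochner_Integration.integrable_bound
        [OF integrable_mult_right[OF integrable_norm[OF kI], of "LINT y|lborel. norm (p y)"]])
      show "AE x in lborel. norm (LINT y|lborel. norm (f (x, y)))
          \<le> norm ((LINT y|lborel. norm (p y)) * norm (k x))"
      proof (rule AE_I2)
        fix x
        have "(LINT y|lborel. norm (f (x, y))) \<le> (LINT y|lborel. norm (k x) * norm (p y))"
          by (intro integral_mono integrable_norm[OF f_int] integrable_mult_right integrable_norm[OF pI])
            (auto simp: f_def norm_mult)
        then show "norm (LINT y|lborel. norm (f (x, y)))
            \<le> norm ((LINT y|lborel. norm (p y)) * norm (k x))"
          by (simp add: mult.commute)
      qed
    qed measurable
  qed
  then have swap: "(LINT y|lborel. LINT x|lborel. f (x, y)) = (LINT x|lborel. LINT y|lborel. f (x, y))"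
    using lborel_pair.Fubini_integral[of "curry f"] by simp
  have hx: "h integrable_on {a..s}" "h absolutely_integrable_on {a..s}" if "s \<le> b" for s
  proof -
    show "h absolutely_integrable_on {a..s}"
      using that by (intro set_integrable_subset[OF h]) auto
    then show "h integrable_on {a..s}"
      using set_lebesgue_integral_eq_integral(1) by blast
  qed
  \<comment> \<open>Integration over \<open>x\<close> first produces the primitive of
    \<open>h\<close>; integration over the second variable first recovers \<open>- \<phi>\<close> by
    the fundamental theorem and \<open>\<phi> b = 0\<close>.\<close>
  have inner1: "(LINT x|lborel. f (x, s)) = indicator {a..b} s *\<^sub>R (integral {a..s} h * \<phi>' s)" for s
  proof (cases "s \<in> {a..b}")
    case True
    have "(LINT x|lborel. f (x, s)) = (LINT x|lborel. indicator {..s} x *\<^sub>R k x) * p s"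
      unfolding integral_mult_left_zero[symmetric]
      by (rule Bochner_Integration.integral_cong) (auto simp: f_def indicator_def)
    also have "(LINT x|lborel. indicator {..s} x *\<^sub>R k x) = (LINT x|lebesgue. indicator {..s} x *\<^sub>R k x)"
      by (rule integral_completion[symmetric]) measurable
    also have "\<dots> = (LINT x|lebesgue. indicator {a..s} x *\<^sub>R h x)"
    proof (rule integral_cong_AE)
      show "AE x in lebesgue. indicator {..s} x *\<^sub>R k x = indicator {a..s} x *\<^sub>R h x"
        using k_eq by eventually_elim (use True in \<open>auto simp: indicator_def k_def split: if_splits\<close>)
      show "(\<lambda>x. indicator {a..s} x *\<^sub>R h x) \<in> borel_measurable lebesgue"
        using hx(2)[of s] True by (auto simp: set_integrable_def)
      show "(\<lambda>x. indicator {..s} x *\<^sub>R k x) \<in> borel_measurable lebesgue"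
        by (rule measurable_completion) measurable
    qed
    also have "\<dots> = integral {a..s} h"
      using set_lebesgue_integral_eq_integral(2)[OF hx(2)[of s]] True by (simp add: set_lebesgue_integral_def)
    finally show ?thesis
      using True by (simp add: p_def)
  qed (simp add: f_def p_def)
  have inner2: "(LINT y|lborel. f (x, y)) = - (k x * \<phi> x)" for x
  proof (cases "x \<in> {a..b}")
    case True
    have cont': "continuous_on {x..b} \<phi>'"
      using cont True continuous_on_subset by fastforce
    have "(LINT y|lborel. f (x, y)) = k x * (LINT y|lborel. indicator {x..b} y *\<^sub>R \<phi>' y)"
      unfolding integral_mult_right_zero[symmetric]
      by (rule Bochner_Integration.integral_cong) (use True in \<open>auto simp: f_def p_def indicator_def\<close>)
    also have "(LINT y|lborel. indicator {x..b} y *\<^sub>R \<phi>' y) = \<phi> b - \<phi> x"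
    proof (rule integral_FTC_Icc)
      show "(\<phi> has_vector_derivative \<phi>' y) (at y within {x..b})" if "x \<le> y" "y \<le> b" for y
        using deriv[of y] that True by (auto intro: has_vector_derivative_within_subset)
    qed (use True cont' in auto)
    finally show ?thesis
      using b by simp
  qed (simp add: f_def k_def)
  have Hcont: "continuous_on {a..b} (\<lambda>s. integral {a..s} h)"
    using hx[of b] by (intro indefinite_integral_continuous_1) auto
  have phicont: "continuous_on {a..b} \<phi>"
    using deriv has_vector_derivative_continuous continuous_on_eq_continuous_within by blast
  have mI: "(\<lambda>x. h x * \<phi> x) absolutely_integrable_on {a..b}"
    using absolutely_integrable_bounded_measurable_product[OF bilinear_times, of \<phi> "{a..b}" h] h phicont
    by (simp add: mult.commute continuous_imp_measurable_on_sets_lebesgue compact_imp_bounded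
        compact_continuous_image)
  have "integral {a..b} (\<lambda>x. h x * \<phi> x) = (LINT x|lebesgue. indicator {a..b} x *\<^sub>R (h x * \<phi> x))"
    using set_lebesgue_integral_eq_integral(2)[OF mI] by (simp add: set_lebesgue_integral_def)
  also have "\<dots> = (LINT x|lebesgue. k x * (indicator {a..b} x *\<^sub>R \<phi> x))"
  proof (rule integral_cong_AE)
    show "AE x in lebesgue. indicator {a..b} x *\<^sub>R (h x * \<phi> x) = k x * (indicator {a..b} x *\<^sub>R \<phi> x)"
      using k_eq by eventually_elim (auto simp: indicator_def k_def split: if_splits)
    show "(\<lambda>x. indicator {a..b} x *\<^sub>R (h x * \<phi> x)) \<in> borel_measurable lebesgue"
      using mI by (auto simp: set_integrable_def)
    have "(\<lambda>x. indicator {a..b} x *\<^sub>R \<phi> x) \<in> borel_measurable lborel"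
      using borel_integrable_compact[OF compact_Icc phicont] by auto
    then show "(\<lambda>x. k x * (indicator {a..b} x *\<^sub>R \<phi> x)) \<in> borel_measurable lebesgue"
      by (intro measurable_completion borel_measurable_times k)
  qed
  also have "\<dots> = (LINT x|lborel. k x * (indicator {a..b} x *\<^sub>R \<phi> x))"
  proof (rule integral_completion)
    have "(\<lambda>x. indicator {a..b} x *\<^sub>R \<phi> x) \<in> borel_measurable lborel"
      using borel_integrable_compact[OF compact_Icc phicont] by auto
    then show "(\<lambda>x. k x * (indicator {a..b} x *\<^sub>R \<phi> x)) \<in> borel_measurable lborel"
      by (intro borel_measurable_times k)
  qed
  also have "\<dots> = - (LINT x|lborel. LINT y|lborel. f (x, y))"
  proof -
    have "k x * (indicator {a..b} x *\<^sub>R \<phi> x) = k x * \<phi> x" for x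
      by (simp add: k_def indicator_def)
    then show ?thesis
      by (simp add: inner2)
  qed
  also have "\<dots> = - (LINT s|lborel. indicator {a..b} s *\<^sub>R (integral {a..s} h * \<phi>' s))"
    by (simp add: swap[symmetric] inner1)
  also have "(LINT s|lborel. indicator {a..b} s *\<^sub>R (integral {a..s} h * \<phi>' s))
      = integral {a..b} (\<lambda>s. integral {a..s} h * \<phi>' s)"
  proof -
    have "set_integrable lborel {a..b} (\<lambda>s. integral {a..s} h * \<phi>' s)"
      unfolding set_integrable_def
      by (rule borel_integrable_compact) (auto intro!: continuous_intros Hcont cont)
    then show ?thesis
      using set_borel_integral_eq_integral(2) by (auto simp: set_lebesgue_integral_def)
  qed
  finally show ?thesis .
qed

section \<open>Enclosing intervals and local integrability\<close>

lemma compact_within_open_interval: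
  fixes J K :: "real set"
  assumes "open J" "is_interval J" "0 \<in> J" "compact K" "K \<subseteq> J"
  obtains a b where "a < 0" "0 < b" "K \<subseteq> {a<..<b}" "{a..b} \<subseteq> J"
proof -
  \<comment> \<open>Adjoining 0 puts the base point of \<open>primitive\<close> into the enclosing
    interval and provides a nonempty set when \<open>K\<close> is empty.\<close>
  have K: "compact (insert 0 K)" "insert 0 K \<noteq> {}" "insert 0 K \<subseteq> J"
    using assms by (auto intro: compact_insert)
  obtain s where s: "s \<in> insert 0 K" "\<forall>t\<in>insert 0 K. s \<le> t"
    using compact_attains_inf[OF K(1,2)] by blast
  obtain t where t: "t \<in> insert 0 K" "\<forall>s\<in>insert 0 K. s \<le> t"
    using compact_attains_sup[OF K(1,2)] by blast
  have "s \<in> J" "t \<in> J"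
    using s(1) t(1) K(3) by auto
  then obtain d e where d: "d > 0" "cball s d \<subseteq> J" and e: "e > 0" "cball t e \<subseteq> J"
    using open_contains_cball_eq[OF assms(1)] by blast
  have "s - d \<in> cball s d" "t + e \<in> cball t e"
    using d(1) e(1) by (auto simp: dist_real_def)
  then have ends: "s - d \<in> J" "t + e \<in> J"
    using d(2) e(2) by blast+
  have "{s - d..t + e} \<subseteq> J"
    using mem_is_interval_1_I[OF assms(2) ends] by auto
  moreover have "insert 0 K \<subseteq> {s - d<..<t + e}"
    using s(2) t(2) d(1) e(1) by force
  ultimately show thesis
    using that[of "s - d" "t + e"] by auto
qed

lemma test_functions_zero_outside:
  "\<phi> \<in> test_functions J \<Longrightarrow> x \<notin> J \<Longrightarrow> \<phi> x = 0"
  using closure_subset[of "{x. \<phi> x \<noteq> 0}"] by (auto simp: test_functions_def)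

lemma L1_loc_integrable_test:
  assumes "h \<in> L1_loc J" "\<phi> \<in> test_functions J"
  shows "integrable lebesgue (\<lambda>x. h x * \<phi> x)"
proof -
  define K where "K = closure {x. \<phi> x \<noteq> 0}"
  have K: "compact K" "K \<subseteq> J"
    using assms(2) by (auto simp: test_functions_def K_def)
  have cont: "continuous_on K \<phi>"
    by (rule smooth_on_continuous_on[OF test_functions_smooth[OF assms(2)]])
  have meas: "K \<in> sets lebesgue"
    using K by (simp add: compact_imp_closed)
  have "(\<lambda>x. \<phi> x * h x) absolutely_integrable_on K"
    using K assms(1) meas compact_imp_bounded[OF compact_continuous_image[OF cont K(1)]]
      continuous_imp_measurable_on_sets_lebesgue[OF cont meas]
    by (intro absolutely_integrable_bounded_measurable_product[OF bilinear_times]) (auto simp: L1_loc_def)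
  moreover have "indicator K x *\<^sub>R (\<phi> x * h x) = h x * \<phi> x" for x
    using closure_subset[of "{x. \<phi> x \<noteq> 0}"] by (auto simp: K_def indicator_def)
  ultimately show ?thesis
    by (simp add: set_integrable_def)
qed

lemma C0_subset_Linf_loc: "open J \<Longrightarrow> C0 J \<subseteq> Linf_loc J"
proof
  fix h assume J: "open J" and h: "h \<in> C0 J"
  have "h \<in> borel_measurable (lebesgue_on J)"
    using J h by (intro continuous_imp_measurable_on_sets_lebesgue) (auto simp: C0_def borel_open)
  moreover have "\<exists>C. AE x\<in>K in lebesgue. norm (h x) \<le> C" if "compact K" "K \<subseteq> J" for K
  proof -
    have "continuous_on K h"
      using h that(2) continuous_on_subset by (simp add: C0_def)
    then have "bounded (h ` K)"
      using that(1) compact_continuous_image compact_imp_bounded by blast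
    then show ?thesis
      by (auto simp: bounded_iff)
  qed
  ultimately show "h \<in> Linf_loc J"
    by (simp add: Linf_loc_def)
qed

lemma Linf_loc_subset_L1_loc: "open J \<Longrightarrow> Linf_loc J \<subseteq> L1_loc J"
proof
  fix h assume J: "open J" and h: "h \<in> Linf_loc J"
  have "h absolutely_integrable_on K" if K: "compact K" "K \<subseteq> J" for K
  proof -
    obtain C where C: "AE x\<in>K in lebesgue. norm (h x) \<le> C"
      using h K by (auto simp: Linf_loc_def)
    have Kl: "K \<in> lmeasurable"
      using K(1) by (simp add: lmeasurable_compact)
    have "h \<in> borel_measurable (lebesgue_on K)"
      using h K by (auto simp: Linf_loc_def intro: measurable_restrict_mono)
    then have 1: "(\<lambda>x. indicator K x *\<^sub>R h x) \<in> borel_measurable lebesgue"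
      using Kl by (subst borel_measurable_restrict_space_iff[symmetric]) (auto dest: fmeasurableD)
    have 2: "integrable lebesgue (\<lambda>x. indicator K x *\<^sub>R C)"
      using Kl by (intro integrable_scaleR_left)
        (auto intro!: integrable_real_indicator dest: fmeasurableD fmeasurableD2 simp: less_top)
    have 3: "AE x in lebesgue. norm (indicator K x *\<^sub>R h x) \<le> norm (indicator K x *\<^sub>R C)"
      using C by eventually_elim (auto simp: indicator_def)
    show ?thesis
      unfolding set_integrable_def by (rule Bochner_Integration.integrable_bound[OF 2 1 3])
  qed
  then show "h \<in> L1_loc J"
    by (auto simp: L1_loc_def)
qed

text \<open>The signed integral from 0 to \<open>x\<close>: for \<open>x \<noteq> 0\<close> one of
  the two intervals is empty. The value type is general because bounds compare complex primitives
  with real ones, of norms and constants.\<close>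

definition primitive :: "(real \<Rightarrow> 'a::banach) \<Rightarrow> real \<Rightarrow> 'a" where
  "primitive h x = integral {0..x} h - integral {x..0} h"

lemma primitive_0 [simp]: "primitive h 0 = 0"
  by (simp add: primitive_def)

lemma primitive_nonneg: "0 \<le> x \<Longrightarrow> primitive h x = integral {0..x} h"
  by (cases "x = 0") (auto simp: primitive_def)

lemma primitive_nonpos: "x \<le> 0 \<Longrightarrow> primitive h x = - integral {x..0} h"
  by (cases "x = 0") (auto simp: primitive_def)

text \<open>Links the signed integral to indefinite integrals with fixed left end, whose continuity
  and derivative are known; on \<open>{a..b}\<close> the two differ by a constant.\<close>

lemma primitive_eq:
  assumes h: "h integrable_on {a..b}" and ab: "a \<le> 0" "0 \<le> b" and x: "x \<in> {a..b}"
  shows "primitive h x = integral {a..x} h - integral {a..0} h"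
proof (cases "0 \<le> x")
  case True
  have "h integrable_on {a..x}"
    using h x by (auto intro: integrable_on_subinterval)
  then show ?thesis
    using Henstock_Kurzweil_Integration.integral_combine[of a 0 x h] True ab x
    by (simp add: primitive_nonneg algebra_simps)
next
  case False
  have "h integrable_on {a..0}"
    using h ab by (auto intro: integrable_on_subinterval)
  then show ?thesis
    using Henstock_Kurzweil_Integration.integral_combine[of a x 0 h] False ab x
    by (simp add: primitive_nonpos algebra_simps)
qed

text \<open>The comparison is demanded only for \<open>|t| \<le> |x|\<close>, and \<open>g\<close>
  may depend on \<open>x\<close>; this allows a factor \<open>|t|\<close> to be replaced by
  \<open>|x|\<close> under the integral. The absolute value on the right accounts for negative
  \<open>x\<close>.\<close>

lemma primitive_bound:
  fixes h :: "real \<Rightarrow> 'a::banach"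
  assumes h: "h integrable_on {a..b}" and g: "g integrable_on {a..b}"
    and ab: "a \<le> 0" "0 \<le> b" and x: "x \<in> {a..b}"
    and le: "\<And>t. t \<in> {a..b} \<Longrightarrow> \<bar>t\<bar> \<le> \<bar>x\<bar> \<Longrightarrow> norm (h t) \<le> g t"
  shows "norm (primitive h x) \<le> \<bar>primitive g x\<bar>"
proof (cases "0 \<le> x")
  case True
  have "norm (integral {0..x} h) \<le> integral {0..x} g"
    by (rule Henstock_Kurzweil_Integration.integral_norm_bound_integral)
      (use h g x ab in \<open>auto intro: integrable_on_subinterval intro!: le\<close>)
  then show ?thesis
    using True by (simp add: primitive_nonneg)
next
  case False
  have "norm (integral {x..0} h) \<le> integral {x..0} g"
    by (rule Henstock_Kurzweil_Integration.integral_norm_bound_integral)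
      (use h g x ab in \<open>auto intro: integrable_on_subinterval intro!: le\<close>)
  then show ?thesis
    using False by (simp add: primitive_nonpos)
qed

lemma primitive_const: "primitive (\<lambda>t. c) x = x *\<^sub>R c"
  by (simp add: primitive_def)

lemma primitive_spike:
  assumes "negligible S" "\<And>t. t \<notin> S \<Longrightarrow> g t = f t"
  shows "primitive f = primitive g"
proof -
  have "integral T f = integral T g" for T
    by (rule integral_spike[OF assms(1)]) (use assms(2) in auto)
  then show ?thesis
    by (simp add: primitive_def fun_eq_iff)
qed

lemma continuous_on_primitive:
  fixes h :: "real \<Rightarrow> 'a::banach"
  assumes J: "open J" "is_interval J" "0 \<in> J" and h: "\<And>a b. {a..b} \<subseteq> J \<Longrightarrow> h integrable_on {a..b}"
  shows "continuous_on J (primitive h)"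
proof (rule continuous_at_imp_continuous_on, rule ballI)
  fix x assume x: "x \<in> J"
  obtain a b where ab: "a < 0" "0 < b" "x \<in> {a<..<b}" "{a..b} \<subseteq> J"
    using compact_within_open_interval[OF J, of "{x}"] x by auto
  have "continuous_on {a..b} (\<lambda>x. integral {a..x} h - integral {a..0} h)"
    using h ab by (intro continuous_intros indefinite_integral_continuous_1) auto
  then have "continuous_on {a..b} (primitive h)"
    by (rule continuous_on_eq) (use primitive_eq[of h a b] h ab in auto)
  then show "isCont (primitive h) x"
    using ab(3) by (auto intro: continuous_on_interior)
qed

lemma L1_loc_integrable_on: "h \<in> L1_loc J \<Longrightarrow> {a..b} \<subseteq> J \<Longrightarrow> h integrable_on {a..b}"
  by (rule set_lebesgue_integral_eq_integral(1)) (auto simp: L1_loc_def)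

text \<open>Moving the base point from the left end \<open>a\<close> to 0 changes the primitive by a
  constant. Its contribution is a multiple of the integral of \<open>vderiv \<phi>\<close>, which is
  0 since \<open>\<phi>\<close> vanishes at both ends of an interval around its support.\<close>

lemma test_by_parts:
  assumes J: "open J" "is_interval J" "0 \<in> J" and h: "h \<in> L1_loc J" and phi: "\<phi> \<in> test_functions J"
  shows "(LINT x|lebesgue. h x * \<phi> x) = - (LINT x|lebesgue. primitive h x * vderiv \<phi> x)"
proof -
  have "compact (closure {x. \<phi> x \<noteq> 0})" "closure {x. \<phi> x \<noteq> 0} \<subseteq> J"
    using phi by (auto simp: test_functions_def)
  then obtain a b where ab: "a < 0" "0 < b" "closure {x. \<phi> x \<noteq> 0} \<subseteq> {a<..<b}" "{a..b} \<subseteq> J"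
    by (rule compact_within_open_interval[OF J])
  have phi_ab: "\<phi> \<in> test_functions {a<..<b}"
    using phi ab(3) by (auto simp: test_functions_def)
  have prim_C0: "primitive h \<in> C0 J"
    using continuous_on_primitive[OF J L1_loc_integrable_on[OF h]] by (auto simp: C0_def)
  then have prim_L1: "primitive h \<in> L1_loc J"
    using J(1) C0_subset_Linf_loc Linf_loc_subset_L1_loc by blast
  have reduce: "(LINT x|lebesgue. f x * \<psi> x) = integral {a..b} (\<lambda>x. f x * \<psi> x)"
    if f: "f \<in> L1_loc J" and psi: "\<psi> \<in> test_functions {a<..<b}" for f \<psi>
  proof -
    have zero: "indicator {a..b} x *\<^sub>R (f x * \<psi> x) = f x * \<psi> x" for x
      using test_functions_zero_outside[OF psi, of x] by (auto simp: indicator_def)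
    have "{a<..<b} \<subseteq> J"
      using ab(4) by auto
    then have "\<psi> \<in> test_functions J"
      using psi test_functions_mono by blast
    then have "(\<lambda>x. f x * \<psi> x) absolutely_integrable_on {a..b}"
      using L1_loc_integrable_test[OF f] by (simp add: set_integrable_def zero)
    from set_lebesgue_integral_eq_integral(2)[OF this] show ?thesis
      by (simp add: set_lebesgue_integral_def zero)
  qed
  have h_ab: "h absolutely_integrable_on {a..b}"
    using h ab(4) by (auto simp: L1_loc_def)
  have smooth: "smooth_on UNIV \<phi>"
    by (rule test_functions_smooth[OF phi])
  have deriv: "(\<phi> has_vector_derivative vderiv \<phi> x) (at x within S)" for x S
    using smooth_on_has_vderiv[OF smooth] by (auto intro: has_vector_derivative_at_within)
  have cont: "continuous_on S (vderiv \<phi>)" for S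
    by (rule continuous_on_subset[OF smooth_on_continuous_on[OF smooth_on_vderiv[OF smooth]]]) auto
  have ends: "\<phi> a = 0" "\<phi> b = 0"
    using test_functions_zero_outside[OF phi_ab] by auto
  have hI: "h integrable_on {a..b}"
    by (rule set_lebesgue_integral_eq_integral(1)[OF h_ab])
  have "(vderiv \<phi> has_integral (\<phi> b - \<phi> a)) {a..b}"
    using ab by (intro fundamental_theorem_of_calculus deriv) auto
  then have int0: "integral {a..b} (vderiv \<phi>) = 0"
    using ends by (simp add: integral_unique)
  have "integral {a..b} (\<lambda>x. primitive h x * vderiv \<phi> x)
      = integral {a..b} (\<lambda>x. integral {a..x} h * vderiv \<phi> x - integral {a..0} h * vderiv \<phi> x)"
    using primitive_eq[OF hI] ab by (intro integral_cong) (simp add: left_diff_distrib)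
  also have "\<dots> = integral {a..b} (\<lambda>x. integral {a..x} h * vderiv \<phi> x)"
  proof (subst integral_diff)
    show "(\<lambda>x. integral {a..x} h * vderiv \<phi> x) integrable_on {a..b}"
      by (intro integrable_continuous_real continuous_intros indefinite_integral_continuous_1 hI cont)
    show "(\<lambda>x. integral {a..0} h * vderiv \<phi> x) integrable_on {a..b}"
      by (intro integrable_continuous_real continuous_intros cont)
  qed (simp add: int0)
  also have "\<dots> = - integral {a..b} (\<lambda>x. h x * \<phi> x)"
    using integral_by_parts_indefinite[OF h_ab deriv cont ends(2)] by simp
  finally show ?thesis
    using reduce[OF h phi_ab] reduce[OF prim_L1 test_functions_vderiv[OF phi_ab]] by simp
qed

section \<open>Antiderivatives in the three function classes\<close>

definition euler :: "(real \<Rightarrow> complex) \<Rightarrow> real \<Rightarrow> complex" where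
  "euler f = (\<lambda>x. of_real x * vderiv f x)"

text \<open>\<open>euler \<phi>\<close> has a zero at 0, so the value of \<open>g\<close> there is
  left open; in the continuous case it will be the limit of the quotient.\<close>

lemma test_by_parts_euler:
  assumes J: "open J" "is_interval J" "0 \<in> J" and h: "h \<in> L1_loc J" and phi: "\<phi> \<in> test_functions J"
    and g: "\<And>x. x \<noteq> 0 \<Longrightarrow> g x = - primitive h x / of_real x"
  shows "(LINT x|lebesgue. h x * \<phi> x) = (LINT x|lebesgue. g x * euler \<phi> x)"
proof -
  have "g x * euler \<phi> x = - (primitive h x * vderiv \<phi> x)" for x
    by (cases "x = 0") (auto simp: g euler_def)
  then show ?thesis
    by (simp add: test_by_parts[OF assms(1-5)])
qed

text \<open>A bound \<open>C\<close> for \<open>h\<close> gives \<open>C |x|\<close> for the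
  integral from 0 to \<open>x\<close>, and division by \<open>x\<close> returns to \<open>C\<close>.
  The bound has to be taken on an interval joining \<open>K\<close> to 0, not on \<open>K\<close>
  alone.\<close>

lemma Linf_loc_euler_antiderivative:
  assumes J: "open J" "is_interval J" "0 \<in> J" and h: "h \<in> Linf_loc J"
  shows "\<exists>g\<in>Linf_loc J. \<forall>\<phi>\<in>test_functions J.
    (LINT x|lebesgue. h x * \<phi> x) = (LINT x|lebesgue. g x * euler \<phi> x)"
proof -
  have h1: "h \<in> L1_loc J"
    using h J(1) Linf_loc_subset_L1_loc by blast
  define g where "g = (\<lambda>x. - primitive h x / of_real x)"
  have Jm: "J \<in> sets lebesgue"
    using J(1) by (simp add: borel_open)
  have "primitive h \<in> borel_measurable (lebesgue_on J)"
    by (rule continuous_imp_measurable_on_sets_lebesgue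
        [OF continuous_on_primitive[OF J L1_loc_integrable_on[OF h1]] Jm])
  moreover have "complex_of_real \<in> borel_measurable (lebesgue_on J)"
    by (rule continuous_imp_measurable_on_sets_lebesgue[OF _ Jm]) (intro continuous_intros)
  ultimately have "g \<in> borel_measurable (lebesgue_on J)"
    unfolding g_def by (intro borel_measurable_divide borel_measurable_uminus)
  moreover have "\<exists>C. AE x\<in>K in lebesgue. norm (g x) \<le> C" if K: "compact K" "K \<subseteq> J" for K
  proof -
    obtain a b where ab: "a < 0" "0 < b" "K \<subseteq> {a<..<b}" "{a..b} \<subseteq> J"
      using compact_within_open_interval[OF J K] by blast
    obtain C where "AE x\<in>{a..b} in lebesgue. norm (h x) \<le> C"
      using h ab(4) by (auto simp: Linf_loc_def)
    then obtain S where S: "{x. \<not> (x \<in> {a..b} \<longrightarrow> norm (h x) \<le> C)} \<subseteq> S" "S \<in> null_sets lebesgue"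
      by (auto simp: eventually_ae_filter)
    \<comment> \<open>Setting \<open>h\<close> to 0 on the exceptional null set turns the almost
      everywhere bound into one at every point of \<open>{a..b}\<close>, as
      \<open>primitive_bound\<close> requires, without changing the primitive.\<close>
    define h' where "h' t = (if t \<in> S then 0 else h t)" for t
    have S0: "negligible S"
      using S(2) by (simp add: negligible_iff_null_sets)
    have eq: "primitive h = primitive h'"
      by (rule primitive_spike[OF S0]) (simp add: h'_def)
    have h'I: "h' integrable_on {a..b}"
      using L1_loc_integrable_on[OF h1 ab(4)] S0
      by (rule integrable_spike) (auto simp: h'_def)
    \<comment> \<open>\<open>|C|\<close> also covers the points where \<open>h'\<close> was set to
      0. At \<open>x = 0\<close> the convention for division by zero gives
      \<open>g 0 = 0\<close>.\<close>
    have "norm (g x) \<le> \<bar>C\<bar>" if x: "x \<in> K" for x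
    proof (cases "x = 0")
      case False
      have "norm (h' t) \<le> \<bar>C\<bar>" if "t \<in> {a..b}" for t
        using S(1) that by (force simp: h'_def)
      then have "norm (primitive h' x) \<le> \<bar>primitive (\<lambda>t. \<bar>C\<bar>) x\<bar>"
        using ab x by (intro primitive_bound[OF h'I]) auto
      then show ?thesis
        using False by (simp add: g_def eq primitive_const norm_divide abs_mult field_simps)
    qed (simp add: g_def)
    then show ?thesis
      by (intro exI[of _ "\<bar>C\<bar>"] AE_I2) auto
  qed
  ultimately have "g \<in> Linf_loc J"
    by (simp add: Linf_loc_def)
  then show ?thesis
    using test_by_parts_euler[OF J h1, of _ g] by (intro bexI[of _ g]) (auto simp: g_def)
qed

lemma C0_div_of_real:
  assumes "continuous_on J f" "open J" "0 \<in> J" "((\<lambda>x. f x / of_real x) \<longlongrightarrow> l) (at 0)"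
  shows "(\<lambda>x. if x = 0 then l else f x / of_real x) \<in> C0 J"
  unfolding C0_def mem_Collect_eq
proof (rule continuous_at_imp_continuous_on, rule ballI)
  fix x assume x: "x \<in> J"
  let ?g = "\<lambda>x. if x = 0 then l else f x / of_real x"
  show "isCont ?g x"
  proof (cases "x = 0")
    case True
    have "(?g \<longlongrightarrow> l) (at 0)"
      by (rule Lim_transform_eventually[OF assms(4)]) (auto simp: eventually_at_filter)
    then show ?thesis
      using True by (simp add: isCont_def)
  next
    case False
    have "isCont (\<lambda>x. f x / of_real x) x"
      using False x assms(1,2) by (intro continuous_intros) (auto simp: continuous_on_eq_continuous_at)
    moreover have "\<forall>\<^sub>F y in nhds x. f y / of_real y = ?g y"
      using t1_space_nhds[OF False] by (rule eventually_mono) auto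
    ultimately show ?thesis
      using isCont_cong[of "\<lambda>x. f x / of_real x" ?g x] by simp
  qed
qed

text \<open>Near 0 the quotient is minus a difference quotient of the primitive; by the fundamental
  theorem it converges to \<open>- h 0\<close>, which becomes the value of \<open>g\<close> at
  0.\<close>

lemma C0_euler_antiderivative:
  assumes J: "open J" "is_interval J" "0 \<in> J" and h: "h \<in> C0 J"
  shows "\<exists>g\<in>C0 J. \<forall>\<phi>\<in>test_functions J.
    (LINT x|lebesgue. h x * \<phi> x) = (LINT x|lebesgue. g x * euler \<phi> x)"
proof -
  have h1: "h \<in> L1_loc J"
    using h J(1) C0_subset_Linf_loc Linf_loc_subset_L1_loc by blast
  let ?f = "\<lambda>x. - primitive h x"
  have cont: "continuous_on J ?f"
    using continuous_on_primitive[OF J L1_loc_integrable_on[OF h1]] by (intro continuous_intros) auto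
  have "((\<lambda>x. ?f x / of_real x) \<longlongrightarrow> - h 0) (at 0)"
  proof -
    obtain a b where ab: "a < 0" "0 < b" "{a..b} \<subseteq> J"
      using compact_within_open_interval[OF J, of "{}"] by auto
    have "continuous_on {a..b} h"
      using h ab(3) continuous_on_subset by (auto simp: C0_def)
    then have "((\<lambda>x. integral {a..x} h) has_vector_derivative h 0) (at 0 within {a..b})"
      using ab by (intro integral_has_vector_derivative) auto
    then have "((\<lambda>x. integral {a..x} h - integral {a..0} h) has_vector_derivative h 0 - 0) (at 0 within {a..b})"
      by (intro has_vector_derivative_diff has_vector_derivative_const)
    then have "(primitive h has_vector_derivative h 0) (at 0 within {a..b})"
      using ab L1_loc_integrable_on[OF h1 ab(3)]
      by (intro has_vector_derivative_transform[of 0 "{a..b}" "primitive h", OF _ primitive_eq]) auto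
    then have "(primitive h has_vector_derivative h 0) (at 0)"
      using ab at_within_interior[of 0 "{a..b}"] by simp
    then have "((\<lambda>x. norm (primitive h x - x *\<^sub>R h 0) / norm x) \<longlongrightarrow> 0) (at 0)"
      by (simp add: has_vector_derivative_def has_derivative_at)
    moreover have "\<forall>\<^sub>F x in at 0. norm (primitive h x - x *\<^sub>R h 0) / norm x
        = norm (?f x / of_real x - - h 0)"
    proof -
      have "norm (primitive h x - x *\<^sub>R h 0) / norm x = norm (?f x / of_real x - - h 0)" if "x \<noteq> 0" for x
      proof -
        have "?f x / of_real x - - h 0 = - ((primitive h x - x *\<^sub>R h 0) / of_real x)"
          using that by (simp add: field_simps scaleR_conv_of_real)
        then show ?thesis
          by (simp add: norm_divide del: minus_diff_eq)
      qed
      then show ?thesis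
        by (auto simp: eventually_at_filter)
    qed
    ultimately have "((\<lambda>x. norm (?f x / of_real x - - h 0)) \<longlongrightarrow> 0) (at 0)"
      by (rule Lim_transform_eventually)
    then show ?thesis
      by (rule LIM_zero_cancel[OF tendsto_norm_zero_cancel])
  qed
  note g = C0_div_of_real[OF cont J(1,3) this]
  show ?thesis
    by (intro bexI[OF _ g] ballI test_by_parts_euler[OF J h1]) auto
qed

text \<open>Between 0 and \<open>x\<close> one has \<open>|t h(t)| \<le> |x| |h(t)|\<close>. Hence
  the primitive of \<open>t h(t)\<close>, divided by \<open>x\<close>, is bounded by the integral of
  \<open>|h|\<close> between 0 and \<open>x\<close>. This tends to 0, so the new coefficient extends
  continuously by 0.\<close>

lemma L1_loc_mult_of_real_euler_antiderivative:
  assumes J: "open J" "is_interval J" "0 \<in> J" and h: "h \<in> L1_loc J"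
  shows "\<exists>g\<in>C0 J. \<forall>\<phi>\<in>test_functions J.
    (LINT x|lebesgue. h x * (of_real x * \<phi> x)) = (LINT x|lebesgue. g x * euler \<phi> x)"
proof -
  let ?h = "\<lambda>x. of_real x * h x"
  have h1: "?h \<in> L1_loc J"
    unfolding L1_loc_def
  proof (safe)
    fix K assume K: "compact K" "K \<subseteq> J"
    have Km: "K \<in> sets lebesgue"
      using K by (simp add: compact_imp_closed)
    have cont: "continuous_on K complex_of_real"
      by (intro continuous_intros)
    show "?h absolutely_integrable_on K"
      using K h Km compact_imp_bounded[OF compact_continuous_image[OF cont K(1)]]
        continuous_imp_measurable_on_sets_lebesgue[OF cont Km]
      by (intro absolutely_integrable_bounded_measurable_product[OF bilinear_times]) (auto simp: L1_loc_def)
  qed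
  let ?f = "\<lambda>x. - primitive ?h x" and ?N = "\<lambda>x. norm (h x)"
  have cont: "continuous_on J ?f"
    using continuous_on_primitive[OF J L1_loc_integrable_on[OF h1]] by (intro continuous_intros) auto
  have NI: "?N integrable_on {a..b}" if "{a..b} \<subseteq> J" for a b
    using h that unfolding L1_loc_def absolutely_integrable_on_def by auto
  have "((\<lambda>x. ?f x / of_real x) \<longlongrightarrow> 0) (at 0)"
  proof (rule Lim_null_comparison)
    obtain a b where ab: "a < 0" "0 < b" "{a..b} \<subseteq> J"
      using compact_within_open_interval[OF J, of "{}"] by auto
    have "isCont (primitive ?N) 0"
      using continuous_on_primitive[OF J NI] J by (simp add: continuous_on_eq_continuous_at)
    then show "((\<lambda>x. \<bar>primitive ?N x\<bar>) \<longlongrightarrow> 0) (at 0)"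
      by (auto simp: isCont_def intro: tendsto_rabs_zero)
    have bound: "norm (?f x / of_real x) \<le> \<bar>primitive ?N x\<bar>" if "x \<in> {a<..<b}" for x
    proof (cases "x = 0")
      case False
      have "norm (primitive ?h x) \<le> \<bar>primitive (\<lambda>t. \<bar>x\<bar> * ?N t) x\<bar>"
      proof (rule primitive_bound)
        show "(\<lambda>t. \<bar>x\<bar> * ?N t) integrable_on {a..b}"
          using integrable_cmul[OF NI[OF ab(3)], of "\<bar>x\<bar>"] by simp
      qed (use that ab L1_loc_integrable_on[OF h1 ab(3)] in \<open>auto simp: norm_mult intro: mult_right_mono\<close>)
      also have "primitive (\<lambda>t. \<bar>x\<bar> * ?N t) x = \<bar>x\<bar> * primitive ?N x"
        by (simp add: primitive_def algebra_simps)
      finally show ?thesis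
        using False by (simp add: norm_divide abs_mult field_simps)
    qed simp
    show "\<forall>\<^sub>F x in at 0. norm (?f x / of_real x) \<le> \<bar>primitive ?N x\<bar>"
      using eventually_at_in_open'[of "{a<..<b}" 0] ab bound
      by (auto elim!: eventually_mono)
  qed
  note g = C0_div_of_real[OF cont J(1,3) this]
  show ?thesis
  proof (intro bexI[OF _ g] ballI)
    fix \<phi> assume phi: "\<phi> \<in> test_functions J"
    have "(\<lambda>x. h x * (of_real x * \<phi> x)) = (\<lambda>x. ?h x * \<phi> x)"
      by (simp add: fun_eq_iff)
    then show "(LINT x|lebesgue. h x * (of_real x * \<phi> x))
        = (LINT x|lebesgue. (if x = 0 then 0 else ?f x / of_real x) * euler \<phi> x)"
      using test_by_parts_euler[OF J h1 phi, of "\<lambda>x. if x = 0 then 0 else ?f x / of_real x"]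
      by (simp only: if_False simp_thms)
  qed
qed

subsection \<open>Functionals generated by the Euler operator\<close>

lemma smooth_on_euler: "open U \<Longrightarrow> smooth_on U f \<Longrightarrow> smooth_on U (euler f)"
  unfolding euler_def by (intro smooth_on_mult smooth_on_vderiv) auto

lemma euler_mult:
  assumes "f differentiable at x" "g differentiable at x"
  shows "euler (\<lambda>x. f x * g x) x = euler f x * g x + f x * euler g x"
  using assms by (simp add: euler_def vderiv_mult algebra_simps)

lemma euler_add:
  assumes "smooth_on UNIV f" "smooth_on UNIV g"
  shows "euler (\<lambda>x. f x + g x) = (\<lambda>x. euler f x + euler g x)"
  using assms by (auto simp: euler_def vderiv_add smooth_on_differentiable algebra_simps)

lemma euler_scale:
  assumes "smooth_on UNIV f"
  shows "euler (\<lambda>x. c * f x) = (\<lambda>x. c * euler f x)"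
  using assms euler_mult[of "\<lambda>x. c" _ f] by (auto simp: smooth_on_differentiable euler_def vderiv_def)

lemma test_functions_euler: "\<phi> \<in> test_functions U \<Longrightarrow> euler \<phi> \<in> test_functions U"
proof (rule test_functionsI[OF test_functions_vderiv])
  assume "\<phi> \<in> test_functions U"
  then show "smooth_on UNIV (euler \<phi>)"
    by (intro smooth_on_euler test_functions_smooth) auto
  show "{x. euler \<phi> x \<noteq> 0} \<subseteq> closure {x. vderiv \<phi> x \<noteq> 0}"
    using closure_subset[of "{x. vderiv \<phi> x \<noteq> 0}"] by (auto simp: euler_def)
qed

text \<open>This is \<open>(E + c\<^sub>0) \<dots> (E + c\<^bsub>j-1\<^esub>)\<close>. Condition (b) corresponds to \<open>c\<^sub>j = j + 1\<close>, (c) to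
  \<open>c\<^sub>j = - k - j\<close>, and (d) to \<open>c\<^sub>j = 0\<close>.\<close>

fun euler_prod :: "(nat \<Rightarrow> complex) \<Rightarrow> nat \<Rightarrow> (real \<Rightarrow> complex) \<Rightarrow> real \<Rightarrow> complex" where
  "euler_prod c 0 \<psi> = \<psi>"
| "euler_prod c (Suc j) \<psi> = euler_prod c j (\<lambda>x. euler \<psi> x + c j * \<psi> x)"

section \<open>Products of shifted Euler operators\<close>

lemma smooth_on_euler_shift:
  "smooth_on UNIV \<psi> \<Longrightarrow> smooth_on UNIV (\<lambda>x. euler \<psi> x + c * \<psi> x)"
  by (intro smooth_on_add smooth_on_mult smooth_on_euler) auto

lemma test_functions_euler_shift:
  "\<psi> \<in> test_functions J \<Longrightarrow> (\<lambda>x. euler \<psi> x + c * \<psi> x) \<in> test_functions J"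
  by (intro test_functions_add test_functions_scale test_functions_euler)

lemma test_functions_euler_prod: "\<psi> \<in> test_functions J \<Longrightarrow> euler_prod c j \<psi> \<in> test_functions J"
  by (induction j arbitrary: \<psi>) (simp_all add: test_functions_euler_shift)

lemma euler_prod_add:
  "smooth_on UNIV f \<Longrightarrow> smooth_on UNIV g \<Longrightarrow>
    euler_prod c j (\<lambda>x. f x + g x) = (\<lambda>x. euler_prod c j f x + euler_prod c j g x)"
proof (induction j arbitrary: f g)
  case (Suc j)
  have "(\<lambda>x. euler (\<lambda>x. f x + g x) x + c j * (f x + g x))
      = (\<lambda>x. (euler f x + c j * f x) + (euler g x + c j * g x))"
    by (simp add: euler_add[OF Suc.prems] algebra_simps)
  then show ?case
    using Suc.IH[OF smooth_on_euler_shift smooth_on_euler_shift] Suc.prems by simp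
qed simp

lemma euler_prod_scale:
  "smooth_on UNIV f \<Longrightarrow> euler_prod c j (\<lambda>x. a * f x) = (\<lambda>x. a * euler_prod c j f x)"
proof (induction j arbitrary: f)
  case (Suc j)
  have "(\<lambda>x. euler (\<lambda>x. a * f x) x + c j * (a * f x)) = (\<lambda>x. a * (euler f x + c j * f x))"
    by (simp add: euler_scale[OF Suc.prems] algebra_simps)
  then show ?case
    using Suc.IH[OF smooth_on_euler_shift] Suc.prems by simp
qed simp

lemma euler_prod_euler:
  "smooth_on UNIV f \<Longrightarrow> euler_prod c j (euler f) = euler (euler_prod c j f)"
proof (induction j arbitrary: f)
  case (Suc j)
  have "(\<lambda>x. euler (euler f) x + c j * euler f x) = euler (\<lambda>x. euler f x + c j * f x)"
    using Suc.prems
    by (subst euler_add) (auto simp: euler_scale intro!: smooth_on_euler smooth_on_mult)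
  then show ?case
    using Suc.IH[OF smooth_on_euler_shift] Suc.prems by simp
qed simp

text \<open>The recursion of \<open>euler_prod\<close> applies the newest factor first. Polynomials
  in \<open>E\<close> commute, so that factor may also be applied last, the form suited to an
  induction on \<open>j\<close> with fixed argument.\<close>

lemma euler_prod_Suc:
  assumes "smooth_on UNIV f"
  shows "euler_prod c (Suc j) f = (\<lambda>x. euler (euler_prod c j f) x + c j * euler_prod c j f x)"
  using assms
  by (simp add: euler_prod_add euler_prod_scale euler_prod_euler smooth_on_euler smooth_on_mult)

lemma euler_prod_0_eq: "euler_prod (\<lambda>_. 0) j f = (euler ^^ j) f"
  by (induction j arbitrary: f) (simp_all add: funpow_swap1)

text \<open>Conjugation by \<open>x\<close> shifts the Euler operator:
  \<open>E(x f) = x (E + 1) f\<close>. This frees a factor \<open>x\<close> from under the operators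
  and hands it to the coefficient.\<close>

lemma euler_prod_mult_of_real:
  "smooth_on UNIV f \<Longrightarrow>
    euler_prod (\<lambda>_. 0) j (\<lambda>x. of_real x * f x) = (\<lambda>x. of_real x * euler_prod (\<lambda>_. 1) j f x)"
proof (induction j arbitrary: f)
  case (Suc j)
  have "euler (\<lambda>x. of_real x * f x) = (\<lambda>x. of_real x * (euler f x + 1 * f x))"
    using Suc.prems euler_mult[of of_real _ f] smooth_on_of_real[of UNIV]
    by (auto simp: smooth_on_differentiable euler_def algebra_simps)
  then show ?case
    using Suc.IH[OF smooth_on_euler_shift[of f 1]] Suc.prems by simp
qed simp

text \<open>One derivative is peeled off at a time:
  \<open>d/dx (x^(j+1) f) = x^j (E + j + 1) f\<close>.\<close>

lemma euler_prod_vderiv_xpow: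
  "smooth_on UNIV f \<Longrightarrow>
    euler_prod (\<lambda>j. of_nat (Suc j)) j f = (vderiv ^^ j) (\<lambda>x. of_real x ^ j * f x)"
proof (induction j arbitrary: f)
  case (Suc j)
  have "vderiv (\<lambda>x. of_real x ^ Suc j * f x)
      = (\<lambda>x. of_real x ^ j * (euler f x + of_nat (Suc j) * f x))"
  proof
    fix x
    have "vderiv (\<lambda>x. xpow (Suc j) x * f x) x
        = xpow (Suc j) x * vderiv f x + vderiv (xpow (Suc j)) x * f x"
      using Suc.prems smooth_on_xpow[of UNIV "Suc j"]
      by (intro vderiv_mult) (auto intro: smooth_on_differentiable)
    then show "vderiv (\<lambda>x. of_real x ^ Suc j * f x) x
        = of_real x ^ j * (euler f x + of_nat (Suc j) * f x)"
      unfolding vderiv_xpow by (simp add: euler_def algebra_simps)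
  qed
  moreover have "euler_prod (\<lambda>j. of_nat (Suc j)) (Suc j) f
      = (vderiv ^^ j) (\<lambda>x. of_real x ^ j * (euler f x + of_nat (Suc j) * f x))"
    using Suc.IH[OF smooth_on_euler_shift] Suc.prems by simp
  ultimately show ?case
    by (simp only: funpow_Suc_right comp_apply)
qed simp

lemma euler_xpow_mult:
  assumes "smooth_on UNIV f"
  shows "euler (\<lambda>x. of_real x ^ n * f x) x
    = of_real x ^ Suc n * vderiv f x + of_nat n * (of_real x ^ n * f x)"
proof (cases n)
  case 0
  then show ?thesis by (simp add: euler_def)
next
  case (Suc m)
  have "vderiv (\<lambda>x. xpow n x * f x) x = xpow n x * vderiv f x + vderiv (xpow n) x * f x"
    using assms smooth_on_xpow[of UNIV n]
    by (intro vderiv_mult) (auto intro: smooth_on_differentiable)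
  then show ?thesis
    unfolding Suc vderiv_xpow by (simp add: euler_def algebra_simps)
qed

text \<open>Applied to \<open>x^(k+j) f^(j)\<close>, the operator \<open>E - (k + j)\<close> cancels
  the derivative of the power and leaves \<open>x^(k+j+1) f^(j+1)\<close>.\<close>

lemma euler_prod_xpow_vderiv:
  assumes "smooth_on UNIV f"
  shows "euler_prod (\<lambda>j. - of_nat (k + j)) j (\<lambda>x. of_real x ^ k * f x)
    = (\<lambda>x. of_real x ^ (k + j) * (vderiv ^^ j) f x)"
proof (induction j)
  case (Suc j)
  have smooth: "smooth_on UNIV (\<lambda>x. of_real x ^ k * f x)"
    using assms by (intro smooth_on_mult smooth_on_xpow) auto
  show ?case
    unfolding euler_prod_Suc[OF smooth] Suc.IH euler_xpow_mult[OF smooth_on_funpow_vderiv[OF assms]]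
    by (simp add: algebra_simps)
qed simp

text \<open>\<open>c\<close> only fixes a basis of the polynomials in \<open>E\<close>; by
  \<open>euler_functionals_change\<close> the set is the same for every \<open>c\<close> if
  \<open>F\<close> is one of the function classes below. Membership is decided by the values on
  \<open>test_functions J\<close>, so functionals that agree there are interchangeable.\<close>

definition euler_functionals ::
  "real set \<Rightarrow> (real \<Rightarrow> complex) set \<Rightarrow> (nat \<Rightarrow> complex) \<Rightarrow> ((real \<Rightarrow> complex) \<Rightarrow> complex) set"
where
  "euler_functionals J F c = {v. \<exists>N h. (\<forall>j\<le>N. h j \<in> F) \<and>
     (\<forall>\<psi>\<in>test_functions J. v \<psi> = (\<Sum>j\<le>N. LINT x|lebesgue. h j x * euler_prod c j \<psi> x))}"

text \<open>What the three classes have in common: they are vector spaces of locally integrable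
  functions. Linearity of the integral in the coefficients then makes the functionals a vector space
  too.\<close>

locale function_class =
  fixes J :: "real set" and F :: "(real \<Rightarrow> complex) set"
  assumes open_J: "open J"
    and F_L1_loc: "F \<subseteq> L1_loc J"
    and F_zero: "(\<lambda>x. 0) \<in> F"
    and F_add: "f \<in> F \<Longrightarrow> g \<in> F \<Longrightarrow> (\<lambda>x. f x + g x) \<in> F"
    and F_scale: "f \<in> F \<Longrightarrow> (\<lambda>x. c * f x) \<in> F"
begin

lemma integrable_test:
  "h \<in> F \<Longrightarrow> \<phi> \<in> test_functions J \<Longrightarrow> integrable lebesgue (\<lambda>x. h x * \<phi> x)"
  using F_L1_loc L1_loc_integrable_test by blast

lemma euler_functionals_cong:
  assumes "v \<in> euler_functionals J F c" "\<And>\<psi>. \<psi> \<in> test_functions J \<Longrightarrow> w \<psi> = v \<psi>"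
  shows "w \<in> euler_functionals J F c"
  using assms unfolding euler_functionals_def by auto

lemma euler_functionals_generator:
  assumes "h \<in> F"
  shows "(\<lambda>\<psi>. LINT x|lebesgue. h x * euler_prod c j \<psi> x) \<in> euler_functionals J F c"
proof -
  define h' where "h' i = (if i = j then h else (\<lambda>x. 0))" for i
  have "(\<Sum>i\<le>j. LINT x|lebesgue. h' i x * euler_prod c i \<psi> x)
      = (LINT x|lebesgue. h x * euler_prod c j \<psi> x)" for \<psi>
    by (subst sum.remove[of _ j]) (auto simp: h'_def)
  then show ?thesis
    using assms F_zero unfolding euler_functionals_def
    by (auto intro!: exI[of _ j] exI[of _ h'] simp: h'_def)
qed

lemma euler_functionals_integral:
  "h \<in> F \<Longrightarrow> (\<lambda>\<psi>. LINT x|lebesgue. h x * \<psi> x) \<in> euler_functionals J F c"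
  using euler_functionals_generator[of h c 0] by simp

lemma euler_functionals_add:
  assumes "v \<in> euler_functionals J F c" "w \<in> euler_functionals J F c"
  shows "(\<lambda>\<psi>. v \<psi> + w \<psi>) \<in> euler_functionals J F c"
proof -
  obtain N h where h: "\<forall>j\<le>N. h j \<in> F"
    and v: "\<And>\<psi>. \<psi> \<in> test_functions J \<Longrightarrow>
      v \<psi> = (\<Sum>j\<le>N. LINT x|lebesgue. h j x * euler_prod c j \<psi> x)"
    using assms(1) unfolding euler_functionals_def by auto
  obtain M g where g: "\<forall>j\<le>M. g j \<in> F"
    and w: "\<And>\<psi>. \<psi> \<in> test_functions J \<Longrightarrow>
      w \<psi> = (\<Sum>j\<le>M. LINT x|lebesgue. g j x * euler_prod c j \<psi> x)"
    using assms(2) unfolding euler_functionals_def by auto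
  define h' where "h' j = (if j \<le> N then h j else (\<lambda>x. 0))" for j
  define g' where "g' j = (if j \<le> M then g j else (\<lambda>x. 0))" for j
  have F: "h' j \<in> F" "g' j \<in> F" for j
    using h g F_zero by (auto simp: h'_def g'_def)
  let ?K = "max N M"
  have "v \<psi> + w \<psi> = (\<Sum>j\<le>?K. LINT x|lebesgue. (h' j x + g' j x) * euler_prod c j \<psi> x)"
    if psi: "\<psi> \<in> test_functions J" for \<psi>
  proof -
    have "v \<psi> = (\<Sum>j\<le>?K. LINT x|lebesgue. h' j x * euler_prod c j \<psi> x)"
      unfolding v[OF psi] by (intro sum.mono_neutral_cong_left) (auto simp: h'_def)
    moreover have "w \<psi> = (\<Sum>j\<le>?K. LINT x|lebesgue. g' j x * euler_prod c j \<psi> x)"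
      unfolding w[OF psi] by (intro sum.mono_neutral_cong_left) (auto simp: g'_def)
    ultimately show ?thesis
      using integrable_test[OF F(1) test_functions_euler_prod[OF psi]]
        integrable_test[OF F(2) test_functions_euler_prod[OF psi]]
      by (simp add: distrib_right sum.distrib)
  qed
  then show ?thesis
    using F F_add unfolding euler_functionals_def
    by (auto intro!: exI[of _ ?K] exI[of _ "\<lambda>j x. h' j x + g' j x"])
qed

lemma euler_functionals_scale:
  assumes "v \<in> euler_functionals J F c"
  shows "(\<lambda>\<psi>. a * v \<psi>) \<in> euler_functionals J F c"
proof -
  obtain N h where h: "\<forall>j\<le>N. h j \<in> F"
    and v: "\<And>\<psi>. \<psi> \<in> test_functions J \<Longrightarrow>
      v \<psi> = (\<Sum>j\<le>N. LINT x|lebesgue. h j x * euler_prod c j \<psi> x)"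
    using assms unfolding euler_functionals_def by auto
  have "a * v \<psi> = (\<Sum>j\<le>N. LINT x|lebesgue. (a * h j x) * euler_prod c j \<psi> x)"
    if "\<psi> \<in> test_functions J" for \<psi>
    by (simp add: v[OF that] sum_distrib_left mult.assoc)
  then show ?thesis
    using h F_scale unfolding euler_functionals_def
    by (auto intro!: exI[of _ N] exI[of _ "\<lambda>j x. a * h j x"])
qed

lemma euler_functionals_sum:
  assumes "finite A" "\<And>i. i \<in> A \<Longrightarrow> v i \<in> euler_functionals J F c"
  shows "(\<lambda>\<psi>. \<Sum>i\<in>A. v i \<psi>) \<in> euler_functionals J F c"
  using assms
proof (induction A rule: finite_induct)
  case empty
  show ?case
    using euler_functionals_integral[OF F_zero] by simp
next
  case (insert i A)
  then show ?case
    using euler_functionals_add[of "v i" c "\<lambda>\<psi>. \<Sum>i\<in>A. v i \<psi>"] by simp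
qed

text \<open>In the term of degree \<open>j\<close> write
  \<open>E + d = (E + c j) + (d - c j)\<close>: the first part raises the degree by one, the second
  multiplies the coefficient by a constant.\<close>

lemma euler_functionals_euler_shift:
  assumes "v \<in> euler_functionals J F c"
  shows "(\<lambda>\<psi>. v (\<lambda>x. euler \<psi> x + d * \<psi> x)) \<in> euler_functionals J F c"
proof -
  obtain N h where h: "\<forall>j\<le>N. h j \<in> F"
    and v: "\<And>\<psi>. \<psi> \<in> test_functions J \<Longrightarrow>
      v \<psi> = (\<Sum>j\<le>N. LINT x|lebesgue. h j x * euler_prod c j \<psi> x)"
    using assms unfolding euler_functionals_def by auto
  let ?G = "\<lambda>j i \<psi>. LINT x|lebesgue. h j x * euler_prod c i \<psi> x"
  have "v (\<lambda>x. euler \<psi> x + d * \<psi> x) = (\<Sum>j\<le>N. ?G j (Suc j) \<psi> + (d - c j) * ?G j j \<psi>)"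
    if psi: "\<psi> \<in> test_functions J" for \<psi>
  proof -
    have "?G j j (\<lambda>x. euler \<psi> x + d * \<psi> x) = ?G j (Suc j) \<psi> + (d - c j) * ?G j j \<psi>"
      if j: "j \<le> N" for j
    proof -
      have "(\<lambda>x. euler \<psi> x + d * \<psi> x) = (\<lambda>x. (euler \<psi> x + c j * \<psi> x) + (d - c j) * \<psi> x)"
        by (simp add: algebra_simps)
      then have "euler_prod c j (\<lambda>x. euler \<psi> x + d * \<psi> x)
          = (\<lambda>x. euler_prod c (Suc j) \<psi> x + (d - c j) * euler_prod c j \<psi> x)"
        using test_functions_smooth[OF psi, of UNIV]
        by (simp only: euler_prod_add euler_prod_scale smooth_on_euler_shift smooth_on_mult
            smooth_on_const open_UNIV euler_prod.simps)
      moreover have "integrable lebesgue (\<lambda>x. h j x * euler_prod c i \<psi> x)" for i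
        using h j by (intro integrable_test test_functions_euler_prod psi) auto
      ultimately show ?thesis
        by (simp add: distrib_left mult.left_commute[of "h j _"] del: euler_prod.simps)
    qed
    then show ?thesis
      by (simp add: v[OF test_functions_euler_shift[OF psi]])
  qed
  note eq = this
  have "(\<lambda>\<psi>. \<Sum>j\<le>N. ?G j (Suc j) \<psi> + (d - c j) * ?G j j \<psi>) \<in> euler_functionals J F c"
    using h by (intro euler_functionals_sum euler_functionals_add euler_functionals_scale
        euler_functionals_generator) auto
  then show ?thesis
    by (rule euler_functionals_cong) (rule eq)
qed

lemma euler_functionals_euler_prod:
  assumes "v \<in> euler_functionals J F c"
  shows "(\<lambda>\<psi>. v (euler_prod d j \<psi>)) \<in> euler_functionals J F c"
proof (induction j)
  case (Suc j)
  then show ?case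
    using euler_functionals_euler_shift by simp
qed (simp add: assms)

text \<open>The integral against \<open>h j\<close> has degree 0 and so belongs to the family of any
  \<open>c\<close>; \<open>euler_prod d j\<close> acts on it through \<open>j\<close> shifts, each
  of which preserves the family.\<close>

lemma euler_functionals_change:
  assumes "v \<in> euler_functionals J F d"
  shows "v \<in> euler_functionals J F c"
proof -
  obtain N h where h: "\<forall>j\<le>N. h j \<in> F"
    and v: "\<And>\<psi>. \<psi> \<in> test_functions J \<Longrightarrow>
      v \<psi> = (\<Sum>j\<le>N. LINT x|lebesgue. h j x * euler_prod d j \<psi> x)"
    using assms unfolding euler_functionals_def by auto
  have "(\<lambda>\<psi>. \<Sum>j\<le>N. LINT x|lebesgue. h j x * euler_prod d j \<psi> x) \<in> euler_functionals J F c"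
    using h by (intro euler_functionals_sum euler_functionals_euler_prod[OF euler_functionals_integral])
      auto
  then show ?thesis
    by (rule euler_functionals_cong) (rule v)
qed

text \<open>The Leibniz rule distributes the powers of \<open>E\<close> over \<open>g\<close> and
  \<open>\<psi>\<close>, and the functions \<open>E^i g\<close> end up as smooth factors of the
  coefficients. All shifts are taken to be 0 because \<open>E\<close> itself is a derivation; the
  basis is changed back at the end.\<close>

lemma euler_functionals_mult:
  assumes F_mult: "\<And>f g. smooth_on J g \<Longrightarrow> f \<in> F \<Longrightarrow> (\<lambda>x. f x * g x) \<in> F"
    and v: "v \<in> euler_functionals J F c" and g: "smooth_on J g"
  shows "(\<lambda>\<psi>. v (\<lambda>x. g x * \<psi> x)) \<in> euler_functionals J F c"
proof -
  have gen: "(\<lambda>\<psi>. LINT x|lebesgue. h x * euler_prod (\<lambda>_. 0) j (\<lambda>x. g x * \<psi> x) x)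
      \<in> euler_functionals J F (\<lambda>_. 0)" if "h \<in> F" "smooth_on J g" for h j g
    using that
  proof (induction j arbitrary: g)
    case 0
    then have "(\<lambda>\<psi>. LINT x|lebesgue. (h x * g x) * \<psi> x) \<in> euler_functionals J F (\<lambda>_. 0)"
      by (intro euler_functionals_integral F_mult)
    then show ?case
      by (simp add: mult.assoc)
  next
    case (Suc j)
    let ?P = "\<lambda>g \<psi>. LINT x|lebesgue. h x * euler_prod (\<lambda>_. 0) j (\<lambda>x. g x * \<psi> x) x"
    have g': "smooth_on J (euler g)"
      by (intro smooth_on_euler open_J Suc.prems)
    have "(\<lambda>\<psi>. ?P (euler g) \<psi> + ?P g (\<lambda>x. euler \<psi> x + 0 * \<psi> x)) \<in> euler_functionals J F (\<lambda>_. 0)"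
      by (intro euler_functionals_add Suc.IH Suc.prems g' euler_functionals_euler_shift[OF Suc.IH])
    then show ?case
    proof (rule euler_functionals_cong)
      fix \<psi> assume psi: "\<psi> \<in> test_functions J"
      note T = test_functions_mult[OF _ open_J]
      have psi': "euler \<psi> \<in> test_functions J"
        by (rule test_functions_euler[OF psi])
      \<comment> \<open>\<open>g\<close> may fail to be differentiable outside \<open>J\<close>;
        there both sides vanish because of \<open>\<psi>\<close>.\<close>
      have "euler (\<lambda>x. g x * \<psi> x) x = euler g x * \<psi> x + g x * euler \<psi> x" for x
      proof (cases "x \<in> J")
        case True
        then show ?thesis
          using Suc.prems test_functions_smooth[OF psi, of UNIV]
          by (intro euler_mult) (auto intro: smooth_on_differentiable)
      next
        case False
        then show ?thesis
          using test_functions_zero_outside[OF psi] test_functions_zero_outside[OF psi']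
            test_functions_zero_outside[OF test_functions_euler[OF T[OF psi Suc.prems(2)]]]
          by simp
      qed
      then have "euler_prod (\<lambda>_. 0) (Suc j) (\<lambda>x. g x * \<psi> x)
          = (\<lambda>x. euler_prod (\<lambda>_. 0) j (\<lambda>x. euler g x * \<psi> x) x
               + euler_prod (\<lambda>_. 0) j (\<lambda>x. g x * euler \<psi> x) x)"
        using euler_prod_add[OF test_functions_smooth[OF T[OF psi g']]
            test_functions_smooth[OF T[OF psi' Suc.prems(2)]]] by simp
      moreover have "integrable lebesgue (\<lambda>x. h x * euler_prod (\<lambda>_. 0) j (\<lambda>x. euler g x * \<psi> x) x)"
        by (intro integrable_test test_functions_euler_prod T psi g' Suc.prems)
      moreover have "integrable lebesgue (\<lambda>x. h x * euler_prod (\<lambda>_. 0) j (\<lambda>x. g x * euler \<psi> x) x)"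
        by (intro integrable_test test_functions_euler_prod T psi' Suc.prems)
      ultimately show "(LINT x|lebesgue. h x * euler_prod (\<lambda>_. 0) (Suc j) (\<lambda>x. g x * \<psi> x) x)
          = ?P (euler g) \<psi> + ?P g (\<lambda>x. euler \<psi> x + 0 * \<psi> x)"
        by (simp add: distrib_left del: euler_prod.simps)
    qed
  qed
  obtain N h where h: "\<forall>j\<le>N. h j \<in> F"
    and v': "\<And>\<psi>. \<psi> \<in> test_functions J \<Longrightarrow>
      v \<psi> = (\<Sum>j\<le>N. LINT x|lebesgue. h j x * euler_prod (\<lambda>_. 0) j \<psi> x)"
    using euler_functionals_change[OF v, of "\<lambda>_. 0"] unfolding euler_functionals_def by auto
  have "(\<lambda>\<psi>. \<Sum>j\<le>N. LINT x|lebesgue. h j x * euler_prod (\<lambda>_. 0) j (\<lambda>x. g x * \<psi> x) x)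
      \<in> euler_functionals J F (\<lambda>_. 0)"
    using h g by (intro euler_functionals_sum gen) auto
  then have "(\<lambda>\<psi>. v (\<lambda>x. g x * \<psi> x)) \<in> euler_functionals J F (\<lambda>_. 0)"
    by (rule euler_functionals_cong) (intro v' test_functions_mult open_J g)
  then show ?thesis
    by (rule euler_functionals_change)
qed

text \<open>Terms are collected from the lowest degree upwards: a sum already reduced to degree
  \<open>N\<close> is lifted to \<open>N + 1\<close> by an antiderivative and merged with the
  coefficient of that degree. This is how (d) manages with a single \<open>h\<close>.\<close>

lemma euler_functionals_raise:
  assumes antideriv: "\<And>h. h \<in> F \<Longrightarrow> \<exists>g\<in>F. \<forall>\<phi>\<in>test_functions J.
      (LINT x|lebesgue. h x * \<phi> x) = (LINT x|lebesgue. g x * euler \<phi> x)"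
    and v: "v \<in> euler_functionals J F c"
  obtains N h where "h \<in> F"
    "\<And>\<psi>. \<psi> \<in> test_functions J \<Longrightarrow> v \<psi> = (LINT x|lebesgue. h x * (euler ^^ N) \<psi> x)"
proof -
  have raise: "\<exists>g\<in>F. \<forall>\<psi>\<in>test_functions J.
      (\<Sum>j\<le>N. LINT x|lebesgue. h j x * (euler ^^ j) \<psi> x) = (LINT x|lebesgue. g x * (euler ^^ N) \<psi> x)"
    if "\<forall>j\<le>N. h j \<in> F" for N and h :: "nat \<Rightarrow> real \<Rightarrow> complex"
    using that
  proof (induction N)
    case 0
    then show ?case by auto
  next
    case (Suc N)
    then obtain g where g: "g \<in> F" "\<forall>\<psi>\<in>test_functions J.
      (\<Sum>j\<le>N. LINT x|lebesgue. h j x * (euler ^^ j) \<psi> x) = (LINT x|lebesgue. g x * (euler ^^ N) \<psi> x)"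
      by auto
    obtain g' where g': "g' \<in> F" "\<forall>\<phi>\<in>test_functions J.
      (LINT x|lebesgue. g x * \<phi> x) = (LINT x|lebesgue. g' x * euler \<phi> x)"
      using antideriv[OF g(1)] by auto
    have h: "h (Suc N) \<in> F"
      using Suc.prems by auto
    have "(\<Sum>j\<le>Suc N. LINT x|lebesgue. h j x * (euler ^^ j) \<psi> x)
        = (LINT x|lebesgue. (g' x + h (Suc N) x) * (euler ^^ Suc N) \<psi> x)"
      if psi: "\<psi> \<in> test_functions J" for \<psi>
    proof -
      have T: "(euler ^^ i) \<psi> \<in> test_functions J" for i
        using test_functions_euler_prod[OF psi, of "\<lambda>_. 0" i] by (simp add: euler_prod_0_eq)
      have "(\<Sum>j\<le>Suc N. LINT x|lebesgue. h j x * (euler ^^ j) \<psi> x)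
        = (LINT x|lebesgue. g' x * (euler ^^ Suc N) \<psi> x)
          + (LINT x|lebesgue. h (Suc N) x * (euler ^^ Suc N) \<psi> x)"
        using g(2) g'(2) psi T by simp
      also have "\<dots> = (LINT x|lebesgue. (g' x + h (Suc N) x) * (euler ^^ Suc N) \<psi> x)"
        using integrable_test[OF g'(1) T[of "Suc N"]] integrable_test[OF h T[of "Suc N"]]
        by (simp add: distrib_right)
      finally show ?thesis .
    qed
    then show ?case
      using F_add[OF g'(1) h] by (intro bexI) auto
  qed
  obtain N h where "\<forall>j\<le>N. h j \<in> F" "\<And>\<psi>. \<psi> \<in> test_functions J \<Longrightarrow>
      v \<psi> = (\<Sum>j\<le>N. LINT x|lebesgue. h j x * euler_prod (\<lambda>_. 0) j \<psi> x)"
    using euler_functionals_change[OF v, of "\<lambda>_. 0"] unfolding euler_functionals_def by auto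
  then show thesis
    using raise[of N h] that by (auto simp: euler_prod_0_eq)
qed

end

subsection \<open>The conditions of the theorem\<close>

lemma Linf_loc_subset: "V \<subseteq> U \<Longrightarrow> Linf_loc U \<subseteq> Linf_loc V"
  by (auto simp: Linf_loc_def intro: measurable_restrict_mono)

lemma function_class_L1_loc: "open J \<Longrightarrow> function_class J (L1_loc J)"
  by unfold_locales (auto simp: L1_loc_def set_integral_add(1) absolutely_integrable_on_const)

lemma Linf_loc_mult:
  assumes "f \<in> Linf_loc J" "g \<in> Linf_loc J"
  shows "(\<lambda>x. f x * g x) \<in> Linf_loc J"
proof -
  have "\<exists>C. AE x\<in>K in lebesgue. norm (f x * g x) \<le> C" if K: "compact K" "K \<subseteq> J" for K
  proof -
    obtain C where C: "AE x\<in>K in lebesgue. norm (f x) \<le> C"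
      using assms(1) K by (auto simp: Linf_loc_def)
    obtain D where D: "AE x\<in>K in lebesgue. norm (g x) \<le> D"
      using assms(2) K by (auto simp: Linf_loc_def)
    have "AE x\<in>K in lebesgue. norm (f x * g x) \<le> \<bar>C\<bar> * \<bar>D\<bar>"
      using C D by eventually_elim (auto simp: norm_mult intro!: mult_mono)
    then show ?thesis by blast
  qed
  then show ?thesis
    using assms by (auto simp: Linf_loc_def intro: borel_measurable_times)
qed

lemma function_class_C0: "open J \<Longrightarrow> function_class J (C0 J)"
proof
  assume J: "open J"
  show "C0 J \<subseteq> L1_loc J"
    using C0_subset_Linf_loc[OF J] Linf_loc_subset_L1_loc[OF J] by blast
qed (auto simp: C0_def intro!: continuous_intros)

lemma function_class_Linf_loc: "open J \<Longrightarrow> function_class J (Linf_loc J)"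
proof
  assume J: "open J"
  then show "open J" .
  show "Linf_loc J \<subseteq> L1_loc J"
    by (rule Linf_loc_subset_L1_loc[OF J])
  have const: "(\<lambda>x. c) \<in> Linf_loc J" for c
    by (auto simp: Linf_loc_def)
  then show "(\<lambda>x. 0) \<in> Linf_loc J" .
  show "(\<lambda>x. c * f x) \<in> Linf_loc J" if "f \<in> Linf_loc J" for c f
    using Linf_loc_mult[OF const that] .
  show "(\<lambda>x. f x + g x) \<in> Linf_loc J" if fg: "f \<in> Linf_loc J" "g \<in> Linf_loc J" for f g
  proof -
    have "\<exists>C. AE x\<in>K in lebesgue. norm (f x + g x) \<le> C" if K: "compact K" "K \<subseteq> J" for K
    proof -
      obtain C where C: "AE x\<in>K in lebesgue. norm (f x) \<le> C"
        using fg(1) K by (auto simp: Linf_loc_def)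
      obtain D where D: "AE x\<in>K in lebesgue. norm (g x) \<le> D"
        using fg(2) K by (auto simp: Linf_loc_def)
      have "AE x\<in>K in lebesgue. norm (f x + g x) \<le> C + D"
        using C D by eventually_elim (auto intro: norm_triangle_mono)
      then show ?thesis by blast
    qed
    then show ?thesis
      using fg by (auto simp: Linf_loc_def intro: borel_measurable_add)
  qed
qed

section \<open>Transposition to test functions and the common form of (b), (c), (d)\<close>

lemma funpow_dist_deriv: "(dist_deriv ^^ j) u \<phi> = (-1) ^ j * u ((vderiv ^^ j) \<phi>)"
proof (induction j arbitrary: \<phi>)
  case (Suc j)
  have "(dist_deriv ^^ Suc j) u \<phi> = - (dist_deriv ^^ j) u (vderiv \<phi>)"
    by (simp add: dist_deriv_def)
  then show ?case
    unfolding Suc.IH by (simp add: funpow_swap1[of vderiv])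
qed simp

text \<open>The transpose of \<open>d/dx \<circ> x\<close> is \<open>- E\<close>; thus no shifts
  occur in (d).\<close>

lemma funpow_dist_deriv_mult_of_real:
  "((dist_deriv \<circ> dist_mult of_real) ^^ N) u \<phi> = (-1) ^ N * u ((euler ^^ N) \<phi>)"
proof (induction N arbitrary: \<phi>)
  case (Suc N)
  have "((dist_deriv \<circ> dist_mult of_real) ^^ Suc N) u \<phi>
      = - ((dist_deriv \<circ> dist_mult of_real) ^^ N) u (euler \<phi>)"
    by (simp add: dist_deriv_def dist_mult_def euler_def)
  also have "\<dots> = (-1) ^ Suc N * u ((euler ^^ Suc N) \<phi>)"
    unfolding Suc.IH by (simp add: funpow_swap1[of euler])
  finally show ?case .
qed simp

text \<open>The normal form with which all conditions are compared: \<open>x^k\<close> times a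
  distribution generated by powers of the Euler operator, the multiplication being moved to the test
  function. The choice of the shifts 0 is a normalization.\<close>

definition euler_condition ::
  "(real set \<Rightarrow> (real \<Rightarrow> complex) set) \<Rightarrow> real set \<Rightarrow> nat \<Rightarrow> ((real \<Rightarrow> complex) \<Rightarrow> complex) \<Rightarrow> bool"
where
  "euler_condition F I k \<sigma> \<longleftrightarrow>
     (\<exists>J v. open_subinterval J I \<and> v \<in> euler_functionals J (F J) (\<lambda>_. 0) \<and>
       (\<forall>\<phi>\<in>test_functions J. \<sigma> \<phi> = v (\<lambda>x. of_real x ^ k * \<phi> x)))"

lemma euler_condition_mono:
  assumes "euler_condition F I k \<sigma>" "\<And>J. open J \<Longrightarrow> F J \<subseteq> G J"
  shows "euler_condition G I k \<sigma>"
proof -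
  obtain J v where J: "open_subinterval J I" and v: "v \<in> euler_functionals J (F J) (\<lambda>_. 0)"
    and \<sigma>: "\<forall>\<phi>\<in>test_functions J. \<sigma> \<phi> = v (\<lambda>x. of_real x ^ k * \<phi> x)"
    using assms(1) unfolding euler_condition_def by blast
  have "F J \<subseteq> G J"
    using J assms(2) by (simp add: open_subinterval_def)
  then have "v \<in> euler_functionals J (G J) (\<lambda>_. 0)"
    using v unfolding euler_functionals_def by blast
  then show ?thesis
    using J \<sigma> unfolding euler_condition_def by blast
qed

context
  fixes F :: "real set \<Rightarrow> (real \<Rightarrow> complex) set"
  assumes F: "\<And>J. open J \<Longrightarrow> function_class J (F J)"
begin

text \<open>\<open>B j h\<close> stands for the \<open>j\<close>-th summand of a condition.
  Conditions (b) and (c) differ only in the shifts \<open>c\<close> that their summands produce, so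
  a single argument serves both.\<close>

lemma euler_condition_iff:
  assumes B: "\<And>J h j \<phi>. \<phi> \<in> test_functions J \<Longrightarrow> open J \<Longrightarrow>
      B j h \<phi> = (-1) ^ j * (LINT x|lebesgue. h x * euler_prod c j (\<lambda>x. of_real x ^ k * \<phi> x) x)"
  shows "euler_condition F I k \<sigma> \<longleftrightarrow>
    (\<exists>J N h. open_subinterval J I \<and> (\<forall>j\<le>N. h j \<in> F J) \<and> dist_eq_on J \<sigma> (\<lambda>\<phi>. \<Sum>j\<le>N. B j (h j) \<phi>))"
    (is "_ \<longleftrightarrow> ?R")
proof
  assume "euler_condition F I k \<sigma>"
  then obtain J v where J: "open_subinterval J I" and v: "v \<in> euler_functionals J (F J) (\<lambda>_. 0)"
    and \<sigma>: "\<forall>\<phi>\<in>test_functions J. \<sigma> \<phi> = v (\<lambda>x. of_real x ^ k * \<phi> x)"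
    unfolding euler_condition_def by blast
  have J': "open J"
    using J by (simp add: open_subinterval_def)
  interpret function_class J "F J"
    by (rule F[OF J'])
  obtain N h where h: "\<forall>j\<le>N. h j \<in> F J" and v': "\<And>\<psi>. \<psi> \<in> test_functions J \<Longrightarrow>
      v \<psi> = (\<Sum>j\<le>N. LINT x|lebesgue. h j x * euler_prod c j \<psi> x)"
    using euler_functionals_change[OF v, of c] unfolding euler_functionals_def by auto
  \<comment> \<open>The sign of \<open>j\<close> partial integrations, contained in
    \<open>B\<close>, is compensated in the coefficient.\<close>
  define h' where "h' j = (\<lambda>x. (-1) ^ j * h j x)" for j
  have "\<sigma> \<phi> = (\<Sum>j\<le>N. B j (h' j) \<phi>)" if phi: "\<phi> \<in> test_functions J" for \<phi>
  proof -
    have "B j (h' j) \<phi> = (LINT x|lebesgue. h j x * euler_prod c j (\<lambda>x. of_real x ^ k * \<phi> x) x)" for j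
      unfolding B[OF phi J'] h'_def mult.assoc integral_mult_right_zero
      by (simp flip: mult.assoc power_add)
    then show ?thesis
      using \<sigma> phi v'[OF test_functions_mult[OF phi J' smooth_on_xpow[OF J']]] by simp
  qed
  then show ?R
    using J h F_scale
    by (intro exI[of _ J] exI[of _ N] exI[of _ h']) (auto simp: dist_eq_on_def h'_def)
next
  assume ?R
  then obtain J N h where J: "open_subinterval J I" and h: "\<forall>j\<le>N. h j \<in> F J"
    and \<sigma>: "dist_eq_on J \<sigma> (\<lambda>\<phi>. \<Sum>j\<le>N. B j (h j) \<phi>)"
    by blast
  have J': "open J"
    using J by (simp add: open_subinterval_def)
  interpret function_class J "F J"
    by (rule F[OF J'])
  let ?v = "\<lambda>\<psi>. \<Sum>j\<le>N. (-1) ^ j * (LINT x|lebesgue. h j x * euler_prod c j \<psi> x)"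
  have "?v \<in> euler_functionals J (F J) c"
    using h by (intro euler_functionals_sum euler_functionals_scale euler_functionals_generator) auto
  then have "?v \<in> euler_functionals J (F J) (\<lambda>_. 0)"
    by (rule euler_functionals_change)
  moreover have "\<sigma> \<phi> = ?v (\<lambda>x. of_real x ^ k * \<phi> x)" if phi: "\<phi> \<in> test_functions J" for \<phi>
    using \<sigma> phi by (simp add: dist_eq_on_def B[OF phi J'])
  ultimately show "euler_condition F I k \<sigma>"
    using J unfolding euler_condition_def by blast
qed

lemma cond_b_iff: "cond_b F I k \<sigma> \<longleftrightarrow> euler_condition F I k \<sigma>"
  unfolding cond_b_def
proof (rule euler_condition_iff[symmetric, where c = "\<lambda>j. of_nat (Suc j)"])
  fix J h j \<phi> assume phi: "\<phi> \<in> test_functions J" and J: "open J"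
  have "smooth_on UNIV (\<lambda>x. of_real x ^ k * \<phi> x)"
    by (intro smooth_on_mult smooth_on_xpow test_functions_smooth[OF phi]) auto
  then show "dist_mult (xpow (k + j)) ((dist_deriv ^^ j) (dist_of h)) \<phi>
    = (-1) ^ j * (LINT x|lebesgue. h x * euler_prod (\<lambda>j. of_nat (Suc j)) j (\<lambda>x. of_real x ^ k * \<phi> x) x)"
    by (simp only: euler_prod_vderiv_xpow)
      (simp add: dist_mult_def funpow_dist_deriv dist_of_def power_add mult.assoc mult.left_commute)
qed

lemma cond_c_iff: "cond_c F I k \<sigma> \<longleftrightarrow> euler_condition F I k \<sigma>"
  unfolding cond_c_def
proof (rule euler_condition_iff[symmetric, where c = "\<lambda>j. - of_nat (k + j)"])
  fix J h j \<phi> assume phi: "\<phi> \<in> test_functions J" and J: "open J"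
  show "(dist_deriv ^^ j) (dist_of (\<lambda>x. xpow (k + j) x * h x)) \<phi>
    = (-1) ^ j * (LINT x|lebesgue. h x * euler_prod (\<lambda>j. - of_nat (k + j)) j (\<lambda>x. of_real x ^ k * \<phi> x) x)"
    unfolding euler_prod_xpow_vderiv[OF test_functions_smooth[OF phi]]
    by (simp add: funpow_dist_deriv dist_of_def mult_ac)
qed

text \<open>Stated apart from the equivalence because it involves no antiderivative and is therefore
  available for \<open>L1_loc\<close>.\<close>

lemma cond_d_imp: "cond_d F I k \<sigma> \<Longrightarrow> euler_condition F I k \<sigma>"
proof -
  assume "cond_d F I k \<sigma>"
  then obtain J N h where J: "open_subinterval J I" and h: "h \<in> F J" and \<sigma>: "dist_eq_on J \<sigma>
      (dist_mult (xpow k) (((dist_deriv \<circ> dist_mult of_real) ^^ N) (dist_of h)))"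
    unfolding cond_d_def by blast
  interpret function_class J "F J"
    using F J by (simp add: open_subinterval_def)
  let ?v = "\<lambda>\<psi>. (-1) ^ N * (LINT x|lebesgue. h x * euler_prod (\<lambda>_. 0) N \<psi> x)"
  have "?v \<in> euler_functionals J (F J) (\<lambda>_. 0)"
    by (intro euler_functionals_scale euler_functionals_generator h)
  moreover have "\<sigma> \<phi> = ?v (\<lambda>x. of_real x ^ k * \<phi> x)" if phi: "\<phi> \<in> test_functions J" for \<phi>
    using \<sigma> phi
    by (simp add: dist_eq_on_def dist_mult_def funpow_dist_deriv_mult_of_real dist_of_def euler_prod_0_eq)
  ultimately show ?thesis
    using J unfolding euler_condition_def by blast
qed

lemma cond_d_iff:
  assumes antideriv: "\<And>J h. open J \<Longrightarrow> is_interval J \<Longrightarrow> 0 \<in> J \<Longrightarrow> h \<in> F J \<Longrightarrow>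
    \<exists>g\<in>F J. \<forall>\<phi>\<in>test_functions J.
      (LINT x|lebesgue. h x * \<phi> x) = (LINT x|lebesgue. g x * euler \<phi> x)"
  shows "cond_d F I k \<sigma> \<longleftrightarrow> euler_condition F I k \<sigma>"
proof
  assume "euler_condition F I k \<sigma>"
  then obtain J v where J: "open_subinterval J I" and v: "v \<in> euler_functionals J (F J) (\<lambda>_. 0)"
    and \<sigma>: "\<forall>\<phi>\<in>test_functions J. \<sigma> \<phi> = v (\<lambda>x. of_real x ^ k * \<phi> x)"
    unfolding euler_condition_def by blast
  have J': "open J" "is_interval J" "0 \<in> J"
    using J by (auto simp: open_subinterval_def)
  interpret function_class J "F J"
    by (rule F[OF J'(1)])
  obtain N h where h: "h \<in> F J" and v': "\<And>\<psi>. \<psi> \<in> test_functions J \<Longrightarrow>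
      v \<psi> = (LINT x|lebesgue. h x * (euler ^^ N) \<psi> x)"
    using euler_functionals_raise[OF antideriv[OF J'] v] by blast
  define h' where "h' = (\<lambda>x. (-1) ^ N * h x)"
  have "\<sigma> \<phi> = dist_mult (xpow k) (((dist_deriv \<circ> dist_mult of_real) ^^ N) (dist_of h')) \<phi>"
    if phi: "\<phi> \<in> test_functions J" for \<phi>
    unfolding dist_mult_def[of "xpow k"] funpow_dist_deriv_mult_of_real dist_of_def h'_def mult.assoc
      integral_mult_right_zero
    using \<sigma> phi v'[OF test_functions_mult[OF phi J'(1) smooth_on_xpow[OF J'(1)]]]
    by (simp flip: mult.assoc power_add)
  then show "cond_d F I k \<sigma>"
    using J F_scale[OF h, of "(-1) ^ N"] unfolding cond_d_def dist_eq_on_def h'_def by blast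
qed (rule cond_d_imp)

end

text \<open>One factor of \<open>x^(k+1)\<close> is brought in front of the operators by
  \<open>E^j(x \<psi>) = x (E + 1)^j \<psi>\<close> and absorbed by the coefficient at the price of
  one further \<open>E\<close>: \<open>h x\<close> against \<open>(E + 1)^j \<psi>\<close> becomes
  \<open>g\<close> against \<open>E (E + 1)^j \<psi>\<close>, with \<open>g\<close> continuous. Both
  assertions on a change of order by one follow from this.\<close>

lemma euler_condition_Suc:
  assumes "euler_condition L1_loc I (Suc k) \<sigma>"
  shows "euler_condition C0 I k \<sigma>"
proof -
  obtain J v where J: "open_subinterval J I" and v: "v \<in> euler_functionals J (L1_loc J) (\<lambda>_. 0)"
    and \<sigma>: "\<forall>\<phi>\<in>test_functions J. \<sigma> \<phi> = v (\<lambda>x. of_real x ^ Suc k * \<phi> x)"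
    using assms unfolding euler_condition_def by blast
  have J': "open J" "is_interval J" "0 \<in> J"
    using J by (auto simp: open_subinterval_def)
  interpret function_class J "C0 J"
    by (rule function_class_C0[OF J'(1)])
  obtain N h where h: "\<forall>j\<le>N. h j \<in> L1_loc J" and v': "\<And>\<psi>. \<psi> \<in> test_functions J \<Longrightarrow>
      v \<psi> = (\<Sum>j\<le>N. LINT x|lebesgue. h j x * euler_prod (\<lambda>_. 0) j \<psi> x)"
    using v unfolding euler_functionals_def by auto
  have "\<forall>j\<in>{..N}. \<exists>g. g \<in> C0 J \<and> (\<forall>\<phi>\<in>test_functions J.
      (LINT x|lebesgue. h j x * (of_real x * \<phi> x)) = (LINT x|lebesgue. g x * euler \<phi> x))"
    using L1_loc_mult_of_real_euler_antiderivative[OF J'] h by blast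
  then obtain g where g: "\<And>j. j \<le> N \<Longrightarrow> g j \<in> C0 J"
    "\<And>j \<phi>. j \<le> N \<Longrightarrow> \<phi> \<in> test_functions J \<Longrightarrow>
      (LINT x|lebesgue. h j x * (of_real x * \<phi> x)) = (LINT x|lebesgue. g j x * euler \<phi> x)"
    by (metis atMost_iff bchoice)
  \<comment> \<open>\<open>euler_prod (\<lambda>_. 0) 1 \<psi>\<close> is
    \<open>euler \<psi>\<close>: the extra \<open>E\<close> is commuted to the inside, and
    \<open>euler_functionals_euler_prod\<close> covers each of the two layers.\<close>
  let ?w = "\<lambda>\<psi>. \<Sum>j\<le>N. LINT x|lebesgue. g j x * euler_prod (\<lambda>_. 1) j (euler_prod (\<lambda>_. 0) 1 \<psi>) x"
  have "?w \<in> euler_functionals J (C0 J) (\<lambda>_. 0)"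
    using g(1) by (intro euler_functionals_sum euler_functionals_euler_prod
        euler_functionals_euler_prod[OF euler_functionals_integral]) auto
  moreover have "\<sigma> \<phi> = ?w (\<lambda>x. of_real x ^ k * \<phi> x)" if phi: "\<phi> \<in> test_functions J" for \<phi>
  proof -
    let ?\<psi> = "\<lambda>x. of_real x ^ k * \<phi> x"
    have psi: "?\<psi> \<in> test_functions J"
      by (rule test_functions_mult[OF phi J'(1) smooth_on_xpow[OF J'(1)]])
    have smooth: "smooth_on UNIV ?\<psi>"
      by (rule test_functions_smooth[OF psi])
    have "\<sigma> \<phi> = v (\<lambda>x. of_real x * ?\<psi> x)"
      using \<sigma> phi by (simp add: mult.assoc)
    also have "\<dots> = (\<Sum>j\<le>N. LINT x|lebesgue. h j x * (of_real x * euler_prod (\<lambda>_. 1) j ?\<psi> x))"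
      unfolding v'[OF test_functions_mult[OF psi J'(1) smooth_on_of_real]]
        euler_prod_mult_of_real[OF smooth] ..
    also have "\<dots> = ?w ?\<psi>"
      using g(2) test_functions_euler_prod[OF psi] smooth by (simp add: euler_prod_euler)
    finally show ?thesis .
  qed
  ultimately show ?thesis
    using J unfolding euler_condition_def by blast
qed

section \<open>Tangential operators and their coefficients\<close>

lemma funpow_vderiv_xpow:
  "l \<le> i \<Longrightarrow> (vderiv ^^ l) (xpow i) = (\<lambda>x. fact i / fact (i - l) * of_real x ^ (i - l))"
proof (induction l)
  case (Suc l)
  define m where "m = i - Suc l"
  have m: "i - l = Suc m"
    using Suc.prems by (simp add: m_def)
  have "(vderiv ^^ Suc l) (xpow i) x = fact i / fact m * of_real x ^ m" for x
  proof -
    have "(vderiv ^^ Suc l) (xpow i) x = vderiv (\<lambda>x. fact i / fact (Suc m) * xpow (Suc m) x) x"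
      using Suc by (simp add: m)
    also have "\<dots> = fact i / fact (Suc m) * vderiv (xpow (Suc m)) x"
      by (subst vderiv_mult)
        (use smooth_on_differentiable smooth_on_xpow[of UNIV "Suc m"] in \<open>auto simp: vderiv_def\<close>)
    also have "\<dots> = fact i / fact m * of_real x ^ m"
      unfolding vderiv_xpow by (simp add: divide_simps del: of_nat_Suc)
    finally show ?thesis .
  qed
  then show ?case
    by (simp add: m_def fun_eq_iff)
qed simp

lemma funpow_vderiv_xpow_eq_0:
  assumes "i < l"
  shows "(vderiv ^^ l) (xpow i) = (\<lambda>x. 0)"
proof -
  have "(vderiv ^^ (n + Suc i)) (xpow i) = (\<lambda>x. 0)" for n
  proof (induction n)
    case 0
    have "(vderiv ^^ i) (xpow i) = (\<lambda>x. fact i)"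
      by (simp add: funpow_vderiv_xpow)
    then show ?case
      by simp
  qed simp
  from this[of "l - Suc i"] show ?thesis
    using assms by simp
qed

text \<open>The monomial \<open>x^i\<close> tests the \<open>i\<close>-th coefficient. Derivatives
  of order above \<open>i\<close> kill it, those of lower order \<open>l\<close> contribute
  \<open>x^(i-l)\<close> times a coefficient already known to be divisible by \<open>x^l\<close>,
  and the \<open>i\<close>-th contributes the coefficient times \<open>i!\<close>. Tangency makes
  the total divisible by \<open>x^i\<close>.\<close>

lemma tangential_coefficient:
  assumes D: "tangential U D" and U: "open U" and i: "i < length D"
  shows "\<exists>b. smooth_on U b \<and> (\<forall>x\<in>U. (D ! i) x = of_real x ^ i * b x)"
  using i
proof (induction i rule: less_induct)
  case (less i)
  then have "\<forall>l\<in>{..<i}. \<exists>b. smooth_on U b \<and> (\<forall>x\<in>U. (D ! l) x = of_real x ^ l * b x)"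
    by auto
  then obtain b where b: "\<And>l. l < i \<Longrightarrow> smooth_on U (b l)"
      "\<And>l x. l < i \<Longrightarrow> x \<in> U \<Longrightarrow> (D ! l) x = of_real x ^ l * b l x"
    by (metis lessThan_iff bchoice)
  have "vanishing_fun U i (xpow i)"
    unfolding vanishing_fun_def by (auto intro!: smooth_on_xpow U exI[of _ "\<lambda>x. 1"])
  then have "vanishing_fun U i (apply_fun D (xpow i))"
    using D by (simp add: tangential_def)
  then obtain q where q: "smooth_on U q" "\<And>x. x \<in> U \<Longrightarrow> apply_fun D (xpow i) x = of_real x ^ i * q x"
    by (auto simp: vanishing_fun_def)
  let ?c = "\<lambda>l. fact i / fact (i - l) :: complex"
  \<comment> \<open>Found by solving \<open>q = i! b + \<Sum>_{l<i} i!/(i-l)! b_l\<close> for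
    \<open>b\<close>.\<close>
  let ?b = "\<lambda>x. 1 / fact i * (q x + (-1) * (\<Sum>l<i. ?c l * b l x))"
  have "smooth_on U ?b"
    by (intro smooth_on_mult smooth_on_add smooth_on_sum smooth_on_const U q b) auto
  moreover have "(D ! i) x = of_real x ^ i * ?b x" if x: "x \<in> U" for x
  proof -
    have "of_real x ^ i * q x = (\<Sum>l<length D. (D ! l) x * (vderiv ^^ l) (xpow i) x)"
      using q(2)[OF x] by (simp add: apply_fun_def)
    also have "\<dots> = (\<Sum>l<Suc i. (D ! l) x * (vderiv ^^ l) (xpow i) x)"
      using less.prems by (intro sum.mono_neutral_right) (auto simp: funpow_vderiv_xpow_eq_0)
    also have "\<dots> = (\<Sum>l<i. (D ! l) x * (vderiv ^^ l) (xpow i) x) + (D ! i) x * fact i"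
      by (simp add: funpow_vderiv_xpow)
    also have "(\<Sum>l<i. (D ! l) x * (vderiv ^^ l) (xpow i) x) = (\<Sum>l<i. of_real x ^ i * (?c l * b l x))"
    proof (rule sum.cong)
      fix l assume "l \<in> {..<i}"
      then have l: "l < i" by simp
      have "complex_of_real x ^ i = of_real x ^ l * of_real x ^ (i - l)"
        using l by (simp flip: power_add)
      then show "(D ! l) x * (vderiv ^^ l) (xpow i) x = of_real x ^ i * (?c l * b l x)"
        using l by (simp add: b(2)[OF l x] funpow_vderiv_xpow)
    qed simp
    finally have "(D ! i) x * fact i = of_real x ^ i * q x - (\<Sum>l<i. of_real x ^ i * (?c l * b l x))"
      by simp
    then show ?thesis
      by (simp add: field_simps sum_distrib_left sum_divide_distrib sum_negf)
  qed
  ultimately show ?case by blast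
qed

text \<open>\<open>E(x^m q) = x^m (E q + m q)\<close>: the Euler operator, unlike
  \<open>d/dx\<close>, does not lower the order of vanishing.\<close>

lemma vanishing_fun_euler_shift:
  assumes U: "open U" and f: "vanishing_fun U m f"
  shows "vanishing_fun U m (\<lambda>x. euler f x + c * f x)"
proof -
  obtain q where q: "smooth_on U q" "\<And>x. x \<in> U \<Longrightarrow> f x = of_real x ^ m * q x" and f': "smooth_on U f"
    using f by (auto simp: vanishing_fun_def)
  have "euler f x + c * f x = of_real x ^ m * (euler q x + (of_nat m + c) * q x)" if x: "x \<in> U" for x
  proof -
    have "vderiv f x = vderiv (\<lambda>x. xpow m x * q x) x"
      by (rule vderiv_cong_open[OF U q(2) x])
    then have "euler f x = euler (\<lambda>x. xpow m x * q x) x"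
      by (simp add: euler_def)
    also have "\<dots> = euler (xpow m) x * q x + xpow m x * euler q x"
      using x U q(1) smooth_on_xpow[OF U, of m] by (intro euler_mult) (auto intro: smooth_on_differentiable)
    also have "euler (xpow m) x = of_nat m * of_real x ^ m"
      using euler_xpow_mult[of "\<lambda>x. 1" m x] by (simp add: vderiv_def)
    finally show ?thesis
      by (simp add: q(2)[OF x] algebra_simps)
  qed
  moreover have "smooth_on U (\<lambda>x. euler q x + (of_nat m + c) * q x)"
    "smooth_on U (\<lambda>x. euler f x + c * f x)"
    by (intro smooth_on_add smooth_on_mult smooth_on_euler smooth_on_const U q f')+
  ultimately show ?thesis
    unfolding vanishing_fun_def by blast
qed

lemma vanishing_fun_cong:
  assumes "open U" "vanishing_fun U m f" "\<And>x. x \<in> U \<Longrightarrow> g x = f x"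
  shows "vanishing_fun U m g"
  using assms smooth_on_cong[of U g f] unfolding vanishing_fun_def by auto

text \<open>Since \<open>x^(j+1) d^(j+1)/dx^(j+1) = (E - j) x^j d^j/dx^j\<close>, these operators
  are built from shifted Euler operators. They are the tangential operators hidden in (b).\<close>

lemma vanishing_fun_xpow_vderiv:
  assumes U: "open U" and g: "vanishing_fun U m g"
  shows "vanishing_fun U m (\<lambda>x. of_real x ^ j * (vderiv ^^ j) g x)"
proof (induction j)
  case 0
  then show ?case using g by simp
next
  case (Suc j)
  let ?f = "\<lambda>x. of_real x ^ j * (vderiv ^^ j) g x"
  have g': "smooth_on U ((vderiv ^^ j) g)"
    using g by (intro smooth_on_funpow_vderiv) (simp add: vanishing_fun_def)
  from vanishing_fun_euler_shift[OF U Suc, of "- of_nat j"] show ?case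
  proof (rule vanishing_fun_cong[OF U])
    fix x assume x: "x \<in> U"
    have "euler ?f x = euler (xpow j) x * (vderiv ^^ j) g x + of_real x ^ j * euler ((vderiv ^^ j) g) x"
      using x U g' smooth_on_xpow[OF U, of j] by (intro euler_mult) (auto intro: smooth_on_differentiable)
    also have "euler (xpow j) x = of_nat j * of_real x ^ j"
      using euler_xpow_mult[of "\<lambda>x. 1" j x] by (simp add: vderiv_def)
    finally show "of_real x ^ Suc j * (vderiv ^^ Suc j) g x = euler ?f x + - of_nat j * ?f x"
      by (simp add: euler_def algebra_simps)
  qed
qed

section \<open>Order of vanishing and the common form\<close>

lemma sum_single_coefficient:
  fixes a :: "nat \<Rightarrow> 'a::comm_monoid_add"
  assumes "\<And>i. i < j \<Longrightarrow> a i = 0"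
  shows "(\<Sum>i<Suc j. a i) = a j"
  using assms by simp

text \<open>\<open>x^(k+j) d^j/dx^j\<close> is the product of \<open>x^k\<close>, which vanishes to
  order \<open>k\<close>, and the tangential operator \<open>x^j d^j/dx^j\<close>.\<close>

lemma cond_b_imp_vanishes:
  assumes "cond_b Linf_loc I k \<sigma>"
  shows "vanishes_to_order I k \<sigma>"
proof -
  obtain J N h where J: "open_subinterval J I" and h: "\<forall>j\<le>N. h j \<in> Linf_loc J"
    and \<sigma>: "dist_eq_on J \<sigma> (\<lambda>\<phi>. \<Sum>j\<le>N. dist_mult (xpow (k + j)) ((dist_deriv ^^ j) (dist_of (h j))) \<phi>)"
    using assms unfolding cond_b_def by blast
  have J': "open J"
    using J by (simp add: open_subinterval_def)
  \<comment> \<open>The sum in \<open>vanishes_to_order\<close> starts at 1, so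
    \<open>D (Suc j)\<close> stands for \<open>x^j d^j/dx^j\<close>: a list of \<open>j\<close> zero
    coefficients followed by \<open>x^j\<close>.\<close>
  define D :: "nat \<Rightarrow> diffop" where "D j = replicate (j - 1) (\<lambda>x. 0) @ [xpow (j - 1)]" for j
  have len: "length (D (Suc j)) = Suc j" for j
    by (simp add: D_def)
  have nth: "D (Suc j) ! i = (if i = j then xpow j else (\<lambda>x. 0))" if "i \<le> j" for i j
    using that by (auto simp: D_def nth_append)
  have apply_fun: "apply_fun (D (Suc j)) g = (\<lambda>x. of_real x ^ j * (vderiv ^^ j) g x)" for j g
    unfolding apply_fun_def len by (subst sum_single_coefficient) (simp_all add: nth)
  have tang: "tangential J (D (Suc j))" for j
  proof -
    have "diffop_on J (D (Suc j))"
      unfolding diffop_on_def D_def by (auto intro: smooth_on_xpow J')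
    then show ?thesis
      using vanishing_fun_xpow_vderiv[OF J'] by (simp add: tangential_def apply_fun)
  qed
  \<comment> \<open>For a zero coefficient \<open>apply_dist\<close> evaluates the functional at the
    zero function; that this gives 0 has to be shown.\<close>
  have dist_zero: "(dist_deriv ^^ i) (dist_of u) (\<lambda>x. 0) = 0" for i u
  proof -
    have "(vderiv ^^ i) (\<lambda>x. 0) = (\<lambda>x. 0)"
      by (induction i) auto
    then show ?thesis
      by (simp add: funpow_dist_deriv dist_of_def)
  qed
  have apply_dist: "dist_mult (xpow k) (apply_dist (D (Suc j)) (dist_of u)) \<phi>
      = dist_mult (xpow (k + j)) ((dist_deriv ^^ j) (dist_of u)) \<phi>" for j u \<phi>
    unfolding apply_dist_def len dist_mult_def
    by (subst sum_single_coefficient) (simp_all add: nth dist_zero power_add mult_ac)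
  have van: "vanishing_fun J k (xpow k)"
    unfolding vanishing_fun_def by (auto intro!: smooth_on_xpow J' exI[of _ "\<lambda>x. 1"])
  have "dist_eq_on J \<sigma> (\<lambda>\<phi>. \<Sum>j=1..Suc N. dist_mult (xpow k) (apply_dist (D j) (dist_of (h (j - 1)))) \<phi>)"
  proof -
    have "(\<Sum>j=1..Suc N. dist_mult (xpow k) (apply_dist (D j) (dist_of (h (j - 1)))) \<phi>)
        = (\<Sum>j\<le>N. dist_mult (xpow (k + j)) ((dist_deriv ^^ j) (dist_of (h j))) \<phi>)" for \<phi>
      unfolding One_nat_def sum.shift_bounds_cl_Suc_ivl atMost_atLeast0 by (simp add: apply_dist)
    then show ?thesis
      using \<sigma> by (simp add: dist_eq_on_def)
  qed
  moreover have "h (j - 1) \<in> Linf_loc J \<and> tangential J (D j) \<and> vanishing_fun J k (xpow k)"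
    if "j \<in> {1..Suc N}" for j
    using that h tang[of "j - 1"] van by auto
  ultimately show ?thesis
    using J unfolding vanishes_to_order_def open_subinterval_def
    by (intro exI[of _ J] exI[of _ "Suc N"] exI[of _ "\<lambda>_. xpow k"] exI[of _ D] exI[of _ "\<lambda>j. h (j - 1)"])
      auto
qed

text \<open>With the \<open>i\<close>-th coefficient of \<open>D j\<close> written as
  \<open>x^i b\<close> and \<open>f j\<close> as \<open>x^k q\<close>, the transposed term is, up to
  sign, \<open>d^i/dx^i (x^i g x^k \<phi>)\<close> with \<open>g = b q\<close>: a product of shifted
  Euler operators applied to \<open>g \<psi>\<close>, where \<open>\<psi> = x^k \<phi>\<close>. The
  factor \<open>g\<close> is absorbed by \<open>euler_functionals_mult\<close>.\<close>

lemma vanishes_imp_euler_condition: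
  assumes "vanishes_to_order I k \<sigma>"
  shows "euler_condition Linf_loc I k \<sigma>"
proof -
  obtain U and N :: nat and f D h where U: "open U" "0 \<in> U" "U \<subseteq> I"
    and hU: "\<And>j. j \<in> {1..N} \<Longrightarrow> h j \<in> Linf_loc U"
    and D: "\<And>j. j \<in> {1..N} \<Longrightarrow> tangential U (D j)"
    and f: "\<And>j. j \<in> {1..N} \<Longrightarrow> vanishing_fun U k (f j)"
    and \<sigma>: "dist_eq_on U \<sigma> (\<lambda>\<phi>. \<Sum>j=1..N. dist_mult (f j) (apply_dist (D j) (dist_of (h j))) \<phi>)"
    using assms unfolding vanishes_to_order_def by blast
  \<comment> \<open>\<open>U\<close> may fail to be an interval; a ball around 0 inside it is
    one.\<close>
  obtain r where r: "r > 0" "ball 0 r \<subseteq> U"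
    using U(1,2) open_contains_ball_eq by blast
  define J where "J = ball (0::real) r"
  have J: "open J" "J \<subseteq> U" "open_subinterval J I"
    using r U(3) by (auto simp: J_def open_subinterval_def is_interval_ball_real)
  interpret function_class J "Linf_loc J"
    by (rule function_class_Linf_loc[OF J(1)])
  have F_mult: "(\<lambda>x. u x * g x) \<in> Linf_loc J" if "smooth_on J g" "u \<in> Linf_loc J" for u g
  proof -
    have "g \<in> C0 J"
      unfolding C0_def using smooth_on_continuous_on[OF that(1)] by simp
    then show ?thesis
      using Linf_loc_mult[OF that(2)] C0_subset_Linf_loc[OF J(1)] by blast
  qed
  have h: "h j \<in> Linf_loc J" if "j \<in> {1..N}" for j
    using hU[OF that] Linf_loc_subset[OF J(2)] by blast
  have "\<forall>j\<in>{1..N}. \<exists>q. smooth_on U q \<and> (\<forall>x\<in>U. f j x = of_real x ^ k * q x)"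
    using f by (auto simp: vanishing_fun_def)
  then obtain q where q: "\<forall>j\<in>{1..N}. smooth_on U (q j) \<and> (\<forall>x\<in>U. f j x = of_real x ^ k * q j x)"
    by (rule bchoice[THEN exE])
  have "\<forall>ji\<in>(SIGMA j:{1..N}. {..<length (D j)}). \<exists>b. smooth_on U b \<and>
      (\<forall>x\<in>U. (D (fst ji) ! snd ji) x = of_real x ^ snd ji * b x)"
    using tangential_coefficient[OF D U(1)] by auto
  then obtain b where b: "\<forall>ji\<in>(SIGMA j:{1..N}. {..<length (D j)}). smooth_on U (b ji) \<and>
      (\<forall>x\<in>U. (D (fst ji) ! snd ji) x = of_real x ^ snd ji * b ji x)"
    by (rule bchoice[THEN exE])
  define g where "g j i = (\<lambda>x. b (j, i) x * q j x)" for j i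
  have g: "smooth_on J (g j i)" if "j \<in> {1..N}" "i < length (D j)" for j i
  proof -
    have "smooth_on U (g j i)"
      unfolding g_def using that q b by (intro smooth_on_mult U(1)) auto
    then show ?thesis
      by (rule smooth_on_subset) (rule J(2))
  qed
  \<comment> \<open>The factorizations hold on \<open>U\<close> only; outside \<open>J\<close> both
    sides vanish with \<open>\<phi>\<close>. The identity is wanted at every \<open>x\<close>, since
    one function is substituted for the other inside a functional.\<close>
  have Df: "(D j ! i) x * (f j x * \<phi> x) = of_real x ^ i * (g j i x * (of_real x ^ k * \<phi> x))"
    if "j \<in> {1..N}" "i < length (D j)" "\<phi> \<in> test_functions J" for j i x \<phi>
  proof (cases "x \<in> J")
    case True
    then have "x \<in> U"
      using J(2) by blast
    then show ?thesis
      using that q b by (auto simp: g_def)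
  qed (use test_functions_zero_outside[OF that(3)] in auto)
  \<comment> \<open>The shifts are those of \<open>d^i/dx^i \<circ> x^i\<close>, see
    \<open>euler_prod_vderiv_xpow\<close>.\<close>
  let ?c = "\<lambda>j. of_nat (Suc j) :: complex"
  let ?v = "\<lambda>\<psi>. \<Sum>j=1..N. \<Sum>i<length (D j). (-1) ^ i *
    (LINT x|lebesgue. h j x * euler_prod ?c i (\<lambda>x. g j i x * \<psi> x) x)"
  have "?v \<in> euler_functionals J (Linf_loc J) (\<lambda>_. 0)"
  proof (intro euler_functionals_sum euler_functionals_scale)
    fix j i assume "j \<in> {1..N}" "i \<in> {..<length (D j)}"
    then show "(\<lambda>\<psi>. LINT x|lebesgue. h j x * euler_prod ?c i (\<lambda>x. g j i x * \<psi> x) x)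
        \<in> euler_functionals J (Linf_loc J) (\<lambda>_. 0)"
      using euler_functionals_mult[OF F_mult
          euler_functionals_euler_prod[OF euler_functionals_integral[OF h]] g] by simp
  qed auto
  moreover have "\<sigma> \<phi> = ?v (\<lambda>x. of_real x ^ k * \<phi> x)" if phi: "\<phi> \<in> test_functions J" for \<phi>
  proof -
    have phiU: "\<phi> \<in> test_functions U"
      using phi test_functions_mono[OF J(2)] by blast
    have psi: "(\<lambda>x. of_real x ^ k * \<phi> x) \<in> test_functions J"
      by (rule test_functions_mult[OF phi J(1) smooth_on_xpow[OF J(1)]])
    have "dist_mult (f j) (apply_dist (D j) (dist_of (h j))) \<phi>
        = (\<Sum>i<length (D j). (-1) ^ i * (LINT x|lebesgue. h j x *
            euler_prod ?c i (\<lambda>x. g j i x * (of_real x ^ k * \<phi> x)) x))" if j: "j \<in> {1..N}" for j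
      unfolding dist_mult_def apply_dist_def
    proof (rule sum.cong)
      fix i assume "i \<in> {..<length (D j)}"
      then have i: "i < length (D j)" by simp
      have "smooth_on UNIV (\<lambda>x. g j i x * (of_real x ^ k * \<phi> x))"
        by (rule test_functions_smooth[OF test_functions_mult[OF psi J(1) g[OF j i]]])
      then show "(dist_deriv ^^ i) (dist_of (h j)) (\<lambda>x. (D j ! i) x * (f j x * \<phi> x))
          = (-1) ^ i * (LINT x|lebesgue. h j x *
              euler_prod ?c i (\<lambda>x. g j i x * (of_real x ^ k * \<phi> x)) x)"
        by (simp only: Df[OF j i phi] euler_prod_vderiv_xpow funpow_dist_deriv dist_of_def)
    qed simp
    then show ?thesis
      using \<sigma> phiU by (simp add: dist_eq_on_def)
  qed
  ultimately show ?thesis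
    using J(3) unfolding euler_condition_def by blast
qed

theorem lemma3p1:
  fixes I :: "real set" and k :: nat and \<sigma> :: "(real \<Rightarrow> complex) \<Rightarrow> complex"
  assumes "open I" and "is_interval I" and "0 \<in> I"
    and "distribution_on I \<sigma>"
  shows "(vanishes_to_order I k \<sigma> \<longleftrightarrow> cond_b Linf_loc I k \<sigma>) \<and>
         (vanishes_to_order I k \<sigma> \<longleftrightarrow> cond_c Linf_loc I k \<sigma>) \<and>
         (vanishes_to_order I k \<sigma> \<longleftrightarrow> cond_d Linf_loc I k \<sigma>) \<and>
         (vanishes_to_order I (k + 1) \<sigma> \<longrightarrow>
            cond_b C0 I k \<sigma> \<and> cond_c C0 I k \<sigma> \<and> cond_d C0 I k \<sigma>) \<and>
         (k \<ge> 1 \<longrightarrow>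
            cond_b L1_loc I k \<sigma> \<or> cond_c L1_loc I k \<sigma> \<or> cond_d L1_loc I k \<sigma> \<longrightarrow>
            vanishes_to_order I (k - 1) \<sigma>)"
proof -
  note iff_Linf = cond_b_iff[OF function_class_Linf_loc] cond_c_iff[OF function_class_Linf_loc]
    cond_d_iff[OF function_class_Linf_loc Linf_loc_euler_antiderivative]
  note iff_C0 = cond_b_iff[OF function_class_C0] cond_c_iff[OF function_class_C0]
    cond_d_iff[OF function_class_C0 C0_euler_antiderivative]
  have vanishes_iff: "vanishes_to_order I n \<sigma> \<longleftrightarrow> euler_condition Linf_loc I n \<sigma>" for n
    using cond_b_imp_vanishes vanishes_imp_euler_condition iff_Linf(1) by blast
  \<comment> \<open>Bounded coefficients are in particular locally integrable, so the step from
    \<open>Suc k\<close> to \<open>k\<close> applies and yields continuous ones.\<close>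
  have continuous: "euler_condition C0 I k \<sigma>" if "vanishes_to_order I (k + 1) \<sigma>"
    using euler_condition_Suc euler_condition_mono[OF _ Linf_loc_subset_L1_loc] that
    by (simp add: vanishes_iff)
  have integrable: "vanishes_to_order I (k - 1) \<sigma>"
    if "k \<ge> 1" "cond_b L1_loc I k \<sigma> \<or> cond_c L1_loc I k \<sigma> \<or> cond_d L1_loc I k \<sigma>"
  proof -
    \<comment> \<open>\<open>k \<ge> 1\<close> gives \<open>k = Suc (k - 1)\<close>. Condition (d)
      enters through the implication \<open>cond_d_imp\<close>.\<close>
    have "euler_condition L1_loc I (Suc (k - 1)) \<sigma>"
      using that cond_b_iff[OF function_class_L1_loc] cond_c_iff[OF function_class_L1_loc]
        cond_d_imp[OF function_class_L1_loc] by auto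
    then show ?thesis
      using euler_condition_Suc euler_condition_mono[OF _ C0_subset_Linf_loc]
      by (simp add: vanishes_iff)
  qed
  show ?thesis
    using continuous integrable by (auto simp: vanishes_iff iff_Linf iff_C0)
qed

end
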